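(* Let $1\le p<\infty$ and let $X$ be a constant~$1$ $p$-convex generalized function space with the $p$-Daugavet property. Then every weakly compact (continuous linear) operator $T: X\to X$ satisfies the $p$-Daugavet equation $$\sup_{f\in B_X}\bigl\|(f^p+T(f)^p)^{1/p}\bigr\|=(1+\|T\|^p)^{1/p}.$$ Consequently, $X$ cannot be reflexive.
   Context: All Banach spaces are real; $B_X$ is the closed unit ball of $X$. Let $1\le p<\infty$. Generalized function space (g.f.s.): let $\Delta$ be a set and $\{(A_\delta,\Sigma_\delta,\mu_\delta):\delta\in\Delta\}$ a family of measure spaces, and let $L^0(A_\delta,\mu_\delta)$ be the space of classes of $\mu_\delta$-a.e. equal real measurable functions. For $f\in\prod_{\delta\in\Delta}L^0(A_\delta,\mu_\delta)$ put $|f|(\delta)=|f(\delta)|$. A g.f.s. is a Banach space $X$ that is a linear subspace of such a product, with $|f|\in X$ whenever $f\in X$, and whose norm is a lattice norm for the order inherited from the product ($|f|\le|g|$ implies $\|f\|\le\|g\|$). Signed powers: for $f$ in the product, $f^p$ denotes the pointwise signed power $f^p(\delta)=\operatorname{sign}\{f(\delta)\}\,|f(\delta)|^p$ (this need not equal $|f|^p$, even for even integers $p$), and $(\cdot)^{1/p}$ denotes the inverse operation, i.e. $g^{1/p}=\operatorname{sign}\{g\}|g|^{1/p}$ pointwise. A g.f.s. $X$ is constant~$1$ $p$-convex if for every finite family $x_1,\dots,x_n\in X$ the function $(\sum_{i=1}^n x_i^p)^{1/p}$ belongs to $X$ and $\|(\sum_{i=1}^n|x_i|^p)^{1/p}\|\le(\sum_{i=1}^n\|x_i\|^p)^{1/p}$.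 A constant~$1$ $p$-convex g.f.s. $X$ has the $p$-Daugavet property if every rank one continuous linear operator $T: X\to X$ satisfies the $p$-Daugavet equation $\sup_{f\in B_X}\|(f^p+T(f)^p)^{1/p}\|=(1+\|T\|^p)^{1/p}$. *)

theory Defs
  imports "HOL-Analysis.Analysis"
begin

section \<open>Generalized function spaces\<close>

text \<open>
  Elements of the product of the spaces L^0(M d), d in D, are written as families
  f :: 'd => 'a => real of representatives; equality and order in the product hold almost
  everywhere in each coordinate.  The common carrier type 'a is no restriction: the spaces
  space (M d) are arbitrary subsets of it.
\<close>

definition ae_eq :: "'d set \<Rightarrow> ('d \<Rightarrow> 'a measure) \<Rightarrow> ('d \<Rightarrow> 'a \<Rightarrow> real) \<Rightarrow> ('d \<Rightarrow> 'a \<Rightarrow> real) \<Rightarrow> bool" where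
  "ae_eq D M f g \<longleftrightarrow> (\<forall>d\<in>D. AE a in M d. f d a = g d a)"

definition ae_le :: "'d set \<Rightarrow> ('d \<Rightarrow> 'a measure) \<Rightarrow> ('d \<Rightarrow> 'a \<Rightarrow> real) \<Rightarrow> ('d \<Rightarrow> 'a \<Rightarrow> real) \<Rightarrow> bool" where
  "ae_le D M f g \<longleftrightarrow> (\<forall>d\<in>D. AE a in M d. f d a \<le> g d a)"

text \<open>
  The Banach space X is the type 'x, and rep is its inclusion into the product:
  rep x is a choice of representatives of x.  Injectivity and linearity of rep modulo
  null sets say that X is a linear subspace of the product.
\<close>

locale generalized_function_space =
  fixes D :: "'d set"
    and M :: "'d \<Rightarrow> 'a measure"
    and rep :: "'x::banach \<Rightarrow> 'd \<Rightarrow> 'a \<Rightarrow> real"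
  assumes rep_measurable: "d \<in> D \<Longrightarrow> rep x d \<in> borel_measurable (M d)"
    and rep_inject: "ae_eq D M (rep x) (rep y) \<Longrightarrow> x = y"
    and rep_add: "ae_eq D M (rep (x + y)) (\<lambda>d a. rep x d a + rep y d a)"
    and rep_scaleR: "ae_eq D M (rep (c *\<^sub>R x)) (\<lambda>d a. c * rep x d a)"
    and abs_mem: "\<exists>y. ae_eq D M (rep y) (\<lambda>d a. \<bar>rep x d a\<bar>)"
    and lattice_norm:
      "ae_le D M (\<lambda>d a. \<bar>rep x d a\<bar>) (\<lambda>d a. \<bar>rep y d a\<bar>) \<Longrightarrow> norm x \<le> norm y"

definition in_gfs ::
  "'d set \<Rightarrow> ('d \<Rightarrow> 'a measure) \<Rightarrow> ('x \<Rightarrow> 'd \<Rightarrow> 'a \<Rightarrow> real) \<Rightarrow> ('d \<Rightarrow> 'a \<Rightarrow> real) \<Rightarrow> bool" where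
  "in_gfs D M rep f \<longleftrightarrow> (\<exists>x. ae_eq D M (rep x) f)"

text \<open>The norm in X of a member f of the product; meaningful only if f belongs to X.\<close>

definition gfs_norm ::
  "'d set \<Rightarrow> ('d \<Rightarrow> 'a measure) \<Rightarrow> ('x::real_normed_vector \<Rightarrow> 'd \<Rightarrow> 'a \<Rightarrow> real) \<Rightarrow> ('d \<Rightarrow> 'a \<Rightarrow> real) \<Rightarrow> real" where
  "gfs_norm D M rep f = norm (THE x. ae_eq D M (rep x) f)"

lemma (in generalized_function_space) gfs_norm_eq:
  assumes "ae_eq D M (rep x) f"
  shows "gfs_norm D M rep f = norm x"
proof -
  have "y = x" if y: "ae_eq D M (rep y) f" for y
  proof (rule rep_inject)
    show "ae_eq D M (rep y) (rep x)"
      unfolding ae_eq_def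
    proof
      fix d assume "d \<in> D"
      then have "AE a in M d. rep x d a = f d a" "AE a in M d. rep y d a = f d a"
        using assms y by (auto simp: ae_eq_def)
      then show "AE a in M d. rep y d a = rep x d a" by eventually_elim simp
    qed
  qed
  then have "(THE x. ae_eq D M (rep x) f) = x"
    using assms by (blast intro: the_equality)
  then show ?thesis by (simp add: gfs_norm_def)
qed

section \<open>\<open>p\<close>-convexity and the \<open>p\<close>-Daugavet property\<close>

definition signed_powr :: "real \<Rightarrow> real \<Rightarrow> real" where
  "signed_powr t p = sgn t * \<bar>t\<bar> powr p"

lemma signed_powr_inverse:
  assumes "p > 0"
  shows "signed_powr (signed_powr t p) (1 / p) = t"
  using assms by (auto simp: signed_powr_def sgn_if abs_mult powr_powr)

text \<open>
  In a generalized function space the first clause, applied to the elements |x i|, shows that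
  the function whose norm is taken in the second clause belongs to X as well.
\<close>

definition const1_p_convex ::
  "'d set \<Rightarrow> ('d \<Rightarrow> 'a measure) \<Rightarrow> ('x::real_normed_vector \<Rightarrow> 'd \<Rightarrow> 'a \<Rightarrow> real) \<Rightarrow> real \<Rightarrow> bool" where
  "const1_p_convex D M rep p \<longleftrightarrow>
     (\<forall>(n::nat) (x :: nat \<Rightarrow> 'x).
        in_gfs D M rep (\<lambda>d a. signed_powr (\<Sum>i<n. signed_powr (rep (x i) d a) p) (1 / p)) \<and>
        gfs_norm D M rep (\<lambda>d a. (\<Sum>i<n. \<bar>rep (x i) d a\<bar> powr p) powr (1 / p))
          \<le> (\<Sum>i<n. norm (x i) powr p) powr (1 / p))"

definition p_daugavet_equation ::
  "'d set \<Rightarrow> ('d \<Rightarrow> 'a measure) \<Rightarrow> ('x::real_normed_vector \<Rightarrow> 'd \<Rightarrow> 'a \<Rightarrow> real) \<Rightarrow> real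
     \<Rightarrow> ('x \<Rightarrow>\<^sub>L 'x) \<Rightarrow> bool" where
  "p_daugavet_equation D M rep p T \<longleftrightarrow>
     (SUP f\<in>cball 0 1.
        gfs_norm D M rep (\<lambda>d a.
          signed_powr (signed_powr (rep f d a) p + signed_powr (rep (blinfun_apply T f) d a) p) (1 / p)))
     = (1 + norm T powr p) powr (1 / p)"

definition rank_one :: "('x::real_normed_vector \<Rightarrow>\<^sub>L 'x) \<Rightarrow> bool" where
  "rank_one T \<longleftrightarrow> dim (range (blinfun_apply T)) = 1"

definition p_daugavet_property ::
  "'d set \<Rightarrow> ('d \<Rightarrow> 'a measure) \<Rightarrow> ('x::real_normed_vector \<Rightarrow> 'd \<Rightarrow> 'a \<Rightarrow> real) \<Rightarrow> real \<Rightarrow> bool" where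
  "p_daugavet_property D M rep p \<longleftrightarrow>
     (\<forall>T :: 'x \<Rightarrow>\<^sub>L 'x. rank_one T \<longrightarrow> p_daugavet_equation D M rep p T)"

section \<open>Weakly compact operators and reflexivity\<close>

definition weak_topology :: "'x::real_normed_vector topology" where
  "weak_topology = topology_generated_by
     {blinfun_apply \<phi> -` U | (\<phi> :: 'x \<Rightarrow>\<^sub>L real) U. open U}"

definition weakly_compact_operator :: "('x::real_normed_vector \<Rightarrow>\<^sub>L 'y::real_normed_vector) \<Rightarrow> bool" where
  "weakly_compact_operator T \<longleftrightarrow>
     compactin weak_topology (weak_topology closure_of (blinfun_apply T ` cball 0 1))"

lift_definition bidual_embedding :: "'x::real_normed_vector \<Rightarrow> ('x \<Rightarrow>\<^sub>L real) \<Rightarrow>\<^sub>L real"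
  is "\<lambda>x \<phi>. blinfun_apply \<phi> x"
  by (rule blinfun.bounded_linear_left)

definition reflexive_space :: "'x::real_normed_vector itself \<Rightarrow> bool" where
  "reflexive_space _ \<longleftrightarrow> surj (bidual_embedding :: 'x \<Rightarrow> ('x \<Rightarrow>\<^sub>L real) \<Rightarrow>\<^sub>L real)"

end

theory Submission
  imports Defs
begin

text \<open>
  The rank one case says that, for \<open>g\<close> of norm one and \<open>x\<close> in \<open>X\<close>, every slice
  of the unit ball given by \<open>g\<close> contains some \<open>f\<close> for which the norm of
  \<open>(f^p + (g(f) x)^p)^(1/p)\<close> is almost maximal.  If \<open>T\<close> is weakly compact, then the image of the
  unit ball is dentable: some slice of the unit ball is mapped into a small ball around a vector
  \<open>x\<close> with norm close to that of \<open>T\<close>.  On this slice \<open>T f\<close> is close to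
  \<open>g(f) x\<close>, and \<open>p\<close>-convexity turns the pointwise estimate
  \<open>|a^p - b^p| \<le> \<kappa> |b|^p + C |a - b|^p\<close> for signed powers into a norm estimate that allows
  replacing \<open>g(f) x\<close> by \<open>T f\<close>.  If \<open>X\<close> were reflexive, the operator \<open>f \<mapsto> - f\<close>
  would be weakly compact, but it violates the equation since \<open>f^p + (- f)^p = 0\<close>.
\<close>

section \<open>The Hahn--Banach theorem\<close>

text \<open>Homogeneity is demanded only as an inequality for positive scalars, the form that is
  easy to check for infima; applying it to \<open>c\<close> and to \<open>inverse c\<close> gives
  equality.\<close>

definition sublinear :: "('a::real_vector \<Rightarrow> real) \<Rightarrow> bool" where
  "sublinear q \<longleftrightarrow> (\<forall>x y. q (x + y) \<le> q x + q y) \<and> (\<forall>c>0. \<forall>x. q (c *\<^sub>R x) \<le> c * q x)"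

lemma sublinearD:
  assumes "sublinear q"
  shows "q (x + y) \<le> q x + q y" "c \<ge> 0 \<Longrightarrow> q (c *\<^sub>R x) = c * q x" "- q (- x) \<le> q x"
proof -
  have add: "q (x + y) \<le> q x + q y" and sc: "c > 0 \<Longrightarrow> q (c *\<^sub>R x) \<le> c * q x" for x y c
    using assms by (auto simp: sublinear_def)
  show "q (x + y) \<le> q x + q y" by (rule add)
  have z: "q 0 = 0"
    using sc[of "1/2" 0] sc[of 2 0] by simp
  show "- q (- x) \<le> q x" using add[of x "- x"] z by simp
  show "q (c *\<^sub>R x) = c * q x" if "c \<ge> 0"
  proof (cases "c = 0")
    case False
    with that have "c > 0" by simp
    moreover have "q x \<le> inverse c * q (c *\<^sub>R x)"
      using sc[of "inverse c" "c *\<^sub>R x"] \<open>c > 0\<close> by simp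
    ultimately show ?thesis using sc[of c x] by (auto simp: field_simps intro!: antisym)
  qed (use z in simp)
qed

text \<open>The single \<open>Q i\<close> need not be sublinear: it is enough that some index
  absorbs each sum and each positive multiple. This covers chains of functionals, shifts of one
  functional along a ray, and the functional that separates a point from a convex set.\<close>

lemma sublinear_INF:
  assumes "I \<noteq> {}" and bdd: "\<And>x. bdd_below ((\<lambda>i. Q i x) ` I)"
    and add: "\<And>i j x y. i \<in> I \<Longrightarrow> j \<in> I \<Longrightarrow> \<exists>k\<in>I. Q k (x + y) \<le> Q i x + Q j y"
    and sc: "\<And>i c x. i \<in> I \<Longrightarrow> c > 0 \<Longrightarrow> \<exists>k\<in>I. Q k (c *\<^sub>R x) \<le> c * Q i x"
  shows "sublinear (\<lambda>x. INF i\<in>I. Q i x)"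
proof -
  let ?q = "\<lambda>x. INF i\<in>I. Q i x"
  have low: "?q x \<le> Q i x" if "i \<in> I" for i x
    using that bdd by (rule cINF_lower[rotated])
  have "?q (x + y) \<le> ?q x + ?q y" for x y
  proof -
    have "?q (x + y) - Q i x \<le> Q j y" if "i \<in> I" "j \<in> I" for i j
      using add[OF that, of x y] low[of _ "x + y"] by force
    then have "?q (x + y) - Q i x \<le> ?q y" if "i \<in> I" for i
      using that \<open>I \<noteq> {}\<close> by (intro cINF_greatest) auto
    then have "?q (x + y) - ?q y \<le> ?q x"
      using \<open>I \<noteq> {}\<close> by (intro cINF_greatest) (auto simp: algebra_simps)
    then show ?thesis by simp
  qed
  moreover have "?q (c *\<^sub>R x) \<le> c * ?q x" if "c > 0" for c x
  proof -
    have "?q (c *\<^sub>R x) / c \<le> Q i x" if "i \<in> I" for i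
      using sc[OF that \<open>c > 0\<close>, of x] low[of _ "c *\<^sub>R x"] \<open>c > 0\<close> by (force simp: field_simps)
    then have "?q (c *\<^sub>R x) / c \<le> ?q x"
      using \<open>I \<noteq> {}\<close> by (intro cINF_greatest) auto
    then show ?thesis using that by (simp add: field_simps)
  qed
  ultimately show ?thesis by (simp add: sublinear_def)
qed

text \<open>A minimal sublinear functional \<open>q\<close> coincides with \<open>\<lambda>x. INF t. q (x + t y) - t q y\<close>;
  evaluating at \<open>- y\<close> shows that it is odd, hence linear.\<close>

lemma Hahn_Banach_sublinear:
  assumes p: "sublinear p"
  obtains f where "linear f" "\<And>x. f x \<le> p x"
proof -
  define A where "A = {q. sublinear q \<and> q \<le> p}"
  have "\<exists>m\<in>A. \<forall>q\<in>A. m \<ge> q \<longrightarrow> q = m"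
  proof (rule predicate_Zorn)
    show "partial_order_on A (relation_of (\<ge>) A)"
      by (rule partial_order_on_relation_ofI) auto
    fix C assume C: "C \<in> Chains (relation_of (\<ge>) A)"
    show "\<exists>u\<in>A. \<forall>a\<in>C. a \<ge> u"
    proof (cases "C = {}")
      case True
      then show ?thesis using p by (auto simp: A_def)
    next
      case False
      have CA: "C \<subseteq> A" and cmp: "\<And>q r. q \<in> C \<Longrightarrow> r \<in> C \<Longrightarrow> q \<le> r \<or> r \<le> q"
        using C by (auto simp: Chains_def relation_of_def)
      have sl: "sublinear q" "q x \<le> p x" if "q \<in> C" for q x
        using that CA by (auto simp: A_def le_fun_def)
      \<comment> \<open>A sublinear \<open>q\<close> below \<open>p\<close> is also bounded from
        below: \<open>q x \<ge> - q (- x) \<ge> - p (- x)\<close>.\<close>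
      have bdd: "bdd_below ((\<lambda>q. q x) ` C)" for x
      proof (rule bdd_belowI2)
        fix q assume "q \<in> C"
        then show "- p (- x) \<le> q x"
          using sublinearD(3)[OF sl(1), of q x] sl(2)[of q "- x"] by linarith
      qed
      have "sublinear (\<lambda>x. INF q\<in>C. q x)"
      proof (rule sublinear_INF[OF False bdd])
        fix q r x y assume qr: "q \<in> C" "r \<in> C"
        show "\<exists>k\<in>C. k (x + y) \<le> q x + r y"
          using cmp[OF qr]
        proof
          assume "q \<le> r"
          then have "q y \<le> r y" by (simp add: le_fun_def)
          with sublinearD(1)[OF sl(1)[OF qr(1)], of x y] show ?thesis by (intro bexI[OF _ qr(1)]) linarith
        next
          assume "r \<le> q"
          then have "r x \<le> q x" by (simp add: le_fun_def)
          with sublinearD(1)[OF sl(1)[OF qr(2)], of x y] show ?thesis by (intro bexI[OF _ qr(2)]) linarith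
        qed
      next
        fix q and c :: real and x assume "q \<in> C" "c > 0"
        then show "\<exists>k\<in>C. k (c *\<^sub>R x) \<le> c * q x"
          using sl(1) by (intro bexI[of _ q]) (auto simp: sublinearD(2))
      qed
      moreover have low: "(INF q\<in>C. q x) \<le> q x" if "q \<in> C" for q x
        using that bdd by (rule cINF_lower[rotated])
      moreover have "(INF q\<in>C. q x) \<le> p x" for x
        using False low sl(2) order_trans by fast
      ultimately show ?thesis
        by (intro bexI[of _ "\<lambda>x. INF q\<in>C. q x"]) (auto simp: A_def le_fun_def)
    qed
  qed
  then obtain q where q: "sublinear q" "q \<le> p" and min: "\<And>r. sublinear r \<Longrightarrow> r \<le> q \<Longrightarrow> r = q"
    unfolding A_def using order_trans by blast
  have odd: "q (- y) = - q y" for y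
  proof -
    define Q where "Q t x = q (x + t *\<^sub>R y) - t * q y" for t x
    have bdd: "bdd_below ((\<lambda>t. Q t x) ` {0..})" for x
    proof (rule bdd_belowI2)
      fix t :: real assume "t \<in> {0..}"
      then have "t * q y \<le> q (x + t *\<^sub>R y) + q (- x)"
        using sublinearD(1)[OF q(1), of "x + t *\<^sub>R y" "- x"] sublinearD(2)[OF q(1), of t y] by simp
      then show "- q (- x) \<le> Q t x" by (simp add: Q_def)
    qed
    have low: "(INF t\<in>{0..}. Q t x) \<le> Q t x" if "t \<ge> 0" for t x
      using that by (intro cINF_lower bdd) auto
    have "sublinear (\<lambda>x. INF t\<in>{0..}. Q t x)"
    proof (rule sublinear_INF[OF _ bdd])
      fix s t :: real and x z assume "s \<in> {0..}" "t \<in> {0..}"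
      then show "\<exists>k\<in>{0..}. Q k (x + z) \<le> Q s x + Q t z"
        using sublinearD(1)[OF q(1), of "x + s *\<^sub>R y" "z + t *\<^sub>R y"]
        by (intro bexI[of _ "s + t"]) (auto simp: Q_def algebra_simps)
    next
      fix t c :: real and x assume "t \<in> {0..}" "c > 0"
      then show "\<exists>k\<in>{0..}. Q k (c *\<^sub>R x) \<le> c * Q t x"
        using sublinearD(2)[OF q(1), of c "x + t *\<^sub>R y"]
        by (intro bexI[of _ "c * t"]) (auto simp: Q_def algebra_simps)
    qed simp
    moreover have "(\<lambda>x. INF t\<in>{0..}. Q t x) \<le> q"
      using low[of 0] by (auto simp: le_fun_def Q_def)
    ultimately have "(\<lambda>x. INF t\<in>{0..}. Q t x) = q" by (rule min)
    \<comment> \<open>Since \<open>Q 1 (- y) = q 0 - q y\<close> and \<open>q 0 = 0\<close>, this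
      bounds \<open>q (- y)\<close> by \<open>- q y\<close>; the converse is subadditivity.\<close>
    then have "q (- y) \<le> Q 1 (- y)" using low[of 1 "- y"] by (metis zero_le_one)
    then show ?thesis
      using sublinearD(2)[OF q(1), of 0 0] sublinearD(3)[OF q(1), of y] by (simp add: Q_def)
  qed
  have "linear q"
  proof (rule linearI)
    fix x y c
    show "q (x + y) = q x + q y"
      using sublinearD(1)[OF q(1), of x y] sublinearD(1)[OF q(1), of "- x" "- y"] odd[of "x + y"] odd
      by (simp add: algebra_simps)
    show "q (c *\<^sub>R x) = c *\<^sub>R q x"
      using sublinearD(2)[OF q(1), of c x] sublinearD(2)[OF q(1), of "- c" x] odd[of "c *\<^sub>R x"]
      by (cases "c \<ge> 0") auto
  qed
  then show ?thesis using that q(2) by (auto simp: le_fun_def)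
qed

section \<open>Separation of points from closed convex sets\<close>

text \<open>With \<open>d\<close> the distance from \<open>x\<close> to \<open>C\<close>, the
  infimum \<open>q\<close> of the \<open>Q (t, y)\<close> is sublinear. It lies below the norm (take
  \<open>t = 0\<close>) and is at most \<open>- d\<close> at \<open>x - y\<close> (take
  \<open>t = 1\<close>). A linear \<open>f\<close> below \<open>q\<close> is therefore bounded, and
  \<open>- f\<close> separates with gap \<open>d\<close>.\<close>

lemma separation_point_closed_convex:
  fixes C :: "'a::real_normed_vector set"
  assumes C: "closed C" "convex C" "x \<notin> C"
  obtains \<phi> :: "'a \<Rightarrow>\<^sub>L real" and s where "\<And>y. y \<in> C \<Longrightarrow> \<phi> y \<le> s" "s < \<phi> x"
proof (cases "C = {}")
  case True
  show ?thesis by (rule that[of 0 "-1"]) (use True in auto)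
next
  case False
  define d where "d = infdist x C"
  have d: "d > 0"
    unfolding d_def using C False by (simp add: infdist_pos_not_in_closed)
  have dle: "d \<le> norm (y - x)" if "y \<in> C" for y
    using infdist_le[OF that, of x] by (simp add: d_def dist_norm norm_minus_commute)
  define I where "I = {0::real..} \<times> C"
  define Q where "Q = (\<lambda>(t::real, y) v. norm (v + t *\<^sub>R (y - x)) - t * d)"
  obtain y0 where "y0 \<in> C" using False by blast
  then have y0: "(0, y0) \<in> I" by (simp add: I_def)
  then have ne: "I \<noteq> {}" by blast
  have bdd: "bdd_below ((\<lambda>i. Q i v) ` I)" for v
  proof (rule bdd_belowI2)
    fix i assume "i \<in> I"
    then obtain t y where i: "i = (t, y)" "t \<ge> 0" "y \<in> C" by (auto simp: I_def)
    have "t * d \<le> norm (t *\<^sub>R (y - x))"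
      using dle[OF i(3)] i(2) by (simp add: mult_left_mono)
    also have "\<dots> \<le> norm (v + t *\<^sub>R (y - x)) + norm v"
      by (metis add_diff_cancel_left' norm_triangle_ineq4)
    finally show "- norm v \<le> Q i v" by (simp add: Q_def i)
  qed
  define q where "q v = (INF i\<in>I. Q i v)" for v
  have low: "q v \<le> Q i v" if "i \<in> I" for i v
    unfolding q_def using that bdd by (rule cINF_lower[rotated])
  have "sublinear (\<lambda>v. INF i\<in>I. Q i v)"
  proof (rule sublinear_INF[OF ne bdd])
    fix i j v w assume "i \<in> I" "j \<in> I"
    then obtain t y s z where i: "i = (t, y)" "t \<ge> 0" "y \<in> C" and j: "j = (s, z)" "s \<ge> 0" "z \<in> C"
      by (auto simp: I_def)
    \<comment> \<open>Convexity of \<open>C\<close> enters here: \<open>u\<close> averages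
      \<open>y\<close> and \<open>z\<close> with weights proportional to \<open>t\<close> and
      \<open>s\<close>, so that \<open>(t + s, u)\<close> is the index required. If both weights
      vanish, any point of \<open>C\<close> serves.\<close>
    obtain u where u: "u \<in> C" "(t + s) *\<^sub>R (u - x) = t *\<^sub>R (y - x) + s *\<^sub>R (z - x)"
    proof (cases "t + s = 0")
      case True
      then have "t = 0" "s = 0" using i j by auto
      then show ?thesis using that[of y] i by simp
    next
      case False
      then have pos: "t + s > 0" using i j by simp
      let ?u = "(t / (t + s)) *\<^sub>R y + (s / (t + s)) *\<^sub>R z"
      have "?u \<in> C"
        using C(2) i j pos by (intro convexD) (auto simp: add_divide_distrib[symmetric])
      moreover have "(t + s) *\<^sub>R ?u = t *\<^sub>R y + s *\<^sub>R z"
        using pos by (simp add: scaleR_add_right)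
      then have "(t + s) *\<^sub>R (?u - x) = t *\<^sub>R (y - x) + s *\<^sub>R (z - x)"
        by (simp add: algebra_simps)
      ultimately show ?thesis by (rule that)
    qed
    have "norm (v + w + (t + s) *\<^sub>R (u - x)) \<le> norm (v + t *\<^sub>R (y - x)) + norm (w + s *\<^sub>R (z - x))"
      unfolding u(2) using norm_triangle_ineq[of "v + t *\<^sub>R (y - x)" "w + s *\<^sub>R (z - x)"]
      by (simp add: algebra_simps)
    then show "\<exists>k\<in>I. Q k (v + w) \<le> Q i v + Q j w"
      using i j u by (intro bexI[of _ "(t + s, u)"]) (auto simp: Q_def I_def algebra_simps)
  next
    fix i v and c :: real assume "i \<in> I" "c > 0"
    then obtain t y where i: "i = (t, y)" "t \<ge> 0" "y \<in> C" by (auto simp: I_def)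
    have "norm (c *\<^sub>R v + (c * t) *\<^sub>R (y - x)) = c * norm (v + t *\<^sub>R (y - x))"
      using \<open>c > 0\<close> by (metis abs_of_pos norm_scaleR scaleR_add_right scaleR_scaleR)
    then show "\<exists>k\<in>I. Q k (c *\<^sub>R v) \<le> c * Q i v"
      using i \<open>c > 0\<close> by (intro bexI[of _ "(c * t, y)"]) (auto simp: Q_def I_def right_diff_distrib)
  qed
  then obtain f where f: "linear f" "\<And>v. f v \<le> q v"
    unfolding q_def using Hahn_Banach_sublinear by blast
  have up: "f v \<le> norm v" for v
    using low[OF y0, of v] f(2)[of v] by (simp add: Q_def)
  have "bounded_linear f"
  proof (rule bounded_linear_intro)
    show "norm (f v) \<le> norm v * 1" for v
      using up[of v] up[of "- v"] linear_neg[OF f(1), of v] by auto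
  qed (use f(1) in \<open>auto simp: linear_add linear_scale\<close>)
  then have app: "blinfun_apply (Blinfun f) = f" by (rule bounded_linear_Blinfun_apply)
  show ?thesis
  proof (rule that[of "- Blinfun f" "- f x - d"])
    fix y assume "y \<in> C"
    then have "f (x - y) \<le> - d"
      using low[of "(1, y)" "x - y"] f(2)[of "x - y"] by (auto simp: I_def Q_def)
    then show "blinfun_apply (- Blinfun f) y \<le> - f x - d"
      using linear_diff[OF f(1), of x y] by (simp add: app uminus_blinfun.rep_eq)
  qed (use d in \<open>simp add: app uminus_blinfun.rep_eq\<close>)
qed

text \<open>Separate \<open>x\<close> from the ball of radius \<open>r\<close>: the bound
  \<open>s\<close> of \<open>\<psi>\<close> on that ball is at least \<open>r * norm \<psi>\<close>,
  so \<open>\<psi>\<close> only has to be normalised. The case \<open>r = 0\<close> shows that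
  functionals separate points.\<close>

lemma norming_functional:
  fixes x :: "'a::real_normed_vector"
  assumes "r < norm x" "0 \<le> r"
  obtains \<phi> :: "'a \<Rightarrow>\<^sub>L real" where "norm \<phi> \<le> 1" "r < \<phi> x"
proof -
  obtain \<psi> :: "'a \<Rightarrow>\<^sub>L real" and s where s: "\<And>y. y \<in> cball 0 r \<Longrightarrow> \<psi> y \<le> s" "s < \<psi> x"
    using separation_point_closed_convex[of "cball 0 r" x] assms by auto
  have nz: "norm \<psi> > 0"
    using s(1)[of 0] s(2) assms(2) by (auto simp: order_less_le)
  have "r * norm \<psi> \<le> s"
  proof (cases "r = 0")
    case True
    then show ?thesis using s(1)[of 0] by simp
  next
    case False
    then have "r > 0" using assms by simp
    have "norm \<psi> \<le> s / r"
    proof (rule norm_blinfun_bound)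
      have "0 \<le> s" using s(1)[of 0] \<open>r > 0\<close> by simp
      then show "0 \<le> s / r" using \<open>r > 0\<close> by simp
      fix y
      show "norm (\<psi> y) \<le> s / r * norm y"
      proof (cases "y = 0")
        case False
        have "\<psi> ((r / norm y) *\<^sub>R y) \<le> s" "\<psi> ((- r / norm y) *\<^sub>R y) \<le> s"
          using s(1)[of "(r / norm y) *\<^sub>R y"] s(1)[of "(- r / norm y) *\<^sub>R y"] \<open>r > 0\<close> False by auto
        then show ?thesis
          using \<open>r > 0\<close> False by (auto simp: blinfun.scaleR_right blinfun.minus_right field_simps abs_le_iff)
      qed simp
    qed
    then show ?thesis using \<open>r > 0\<close> by (simp add: field_simps)
  qed
  then have "r < \<psi> x / norm \<psi>" using s(2) nz by (simp add: field_simps)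
  then show ?thesis
    using nz by (intro that[of "inverse (norm \<psi>) *\<^sub>R \<psi>"]) (auto simp: blinfun.scaleR_left field_simps)
qed

section \<open>The weak topology\<close>

lemma topspace_weak_topology [simp]: "topspace weak_topology = (UNIV :: 'a::real_normed_vector set)"
proof -
  have "UNIV = blinfun_apply (0 :: 'a \<Rightarrow>\<^sub>L real) -` UNIV" by simp
  then show ?thesis
    unfolding weak_topology_def topology_generated_by_topspace by blast
qed

lemma continuous_map_weak_topology [simp]:
  "continuous_map weak_topology euclidean (blinfun_apply (\<phi> :: 'a::real_normed_vector \<Rightarrow>\<^sub>L real))"
proof -
  have "openin weak_topology (blinfun_apply \<phi> -` U)" if "open U" for U
    unfolding weak_topology_def using that by (intro topology_generated_by_Basis) blast
  then show ?thesis
    by (auto simp: continuous_map_def vimage_def)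
qed

lemma openin_weak_topology_Collect_less: "openin weak_topology {x. s < blinfun_apply (\<phi> :: 'a::real_normed_vector \<Rightarrow>\<^sub>L real) x}"
  using openin_continuous_map_preimage[OF continuous_map_weak_topology, of "{s<..}" \<phi>] by simp

lemma closedin_weak_topology_Collect_ge: "closedin weak_topology {x. s \<le> blinfun_apply (\<phi> :: 'a::real_normed_vector \<Rightarrow>\<^sub>L real) x}"
  using closedin_continuous_map_preimage[OF continuous_map_weak_topology, of "{s..}" \<phi>] by simp

lemma convex_Collect_ge_blinfun:
  "convex {x. s \<le> blinfun_apply (\<phi> :: 'a::real_normed_vector \<Rightarrow>\<^sub>L real) x}"
  using convex_linear_vimage[OF bounded_linear.linear[OF blinfun.bounded_linear_right[of \<phi>]], of "{s..}"]
  by (simp add: vimage_def)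

text \<open>Makes weakly compact sets weakly closed and gives access to the Baire theorem for
  compact Hausdorff spaces.\<close>

lemma Hausdorff_weak_topology: "Hausdorff_space (weak_topology :: 'a::real_normed_vector topology)"
  unfolding Hausdorff_space_def
proof (intro allI impI)
  fix x y :: 'a assume "x \<in> topspace weak_topology \<and> y \<in> topspace weak_topology \<and> x \<noteq> y"
  then obtain \<phi> :: "'a \<Rightarrow>\<^sub>L real" where "0 < \<phi> (x - y)"
    using norming_functional[of 0 "x - y"] by auto
  then have *: "\<phi> y < \<phi> x" by (simp add: blinfun.diff_right)
  let ?m = "(\<phi> x + \<phi> y) / 2"
  have "openin weak_topology {z. ?m < \<phi> z}" "openin weak_topology {z. \<phi> z < ?m}"
    using openin_weak_topology_Collect_less[of ?m \<phi>] openin_weak_topology_Collect_less[of "- ?m" "- \<phi>"]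
    by (simp_all add: uminus_blinfun.rep_eq)
  then show "\<exists>U V. openin weak_topology U \<and> openin weak_topology V \<and> x \<in> U \<and> y \<in> V \<and> disjnt U V"
    using * by (intro exI[of _ "{z. ?m < \<phi> z}"] exI[of _ "{z. \<phi> z < ?m}"]) (auto simp: disjnt_iff)
qed

text \<open>Mazur's theorem: a separating functional provides a weakly open half-space around each
  point outside \<open>C\<close>.\<close>

lemma closedin_weak_topology_convex:
  assumes "closed C" "convex C"
  shows "closedin weak_topology (C :: 'a::real_normed_vector set)"
proof -
  have "\<exists>U. openin weak_topology U \<and> x \<in> U \<and> U \<subseteq> - C" if x: "x \<notin> C" for x
  proof -
    obtain \<phi> :: "'a \<Rightarrow>\<^sub>L real" and s where "\<And>y. y \<in> C \<Longrightarrow> \<phi> y \<le> s" "s < \<phi> x"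
      using separation_point_closed_convex[OF assms x] by blast
    then show ?thesis
      using openin_weak_topology_Collect_less[of s \<phi>] by (intro exI[of _ "{x. s < \<phi> x}"]) force
  qed
  then have "openin weak_topology (- C)" by (subst openin_subopen) auto
  then show ?thesis by (simp add: closedin_def Compl_eq_Diff_UNIV)
qed

lemma closedin_weak_imp_closed:
  fixes C :: "'a::real_normed_vector set"
  assumes "closedin weak_topology C"
  shows "closed C"
proof -
  have "continuous_map euclidean weak_topology (\<lambda>x :: 'a. x)"
    unfolding weak_topology_def
  proof (rule continuous_on_generated_topo)
    fix U assume "U \<in> {blinfun_apply \<phi> -` U |(\<phi> :: 'a \<Rightarrow>\<^sub>L real) U. open U}"
    then show "openin euclidean ((\<lambda>x. x) -` U \<inter> topspace (euclidean :: 'a topology))"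
      by (auto intro!: open_vimage continuous_intros)
  next
    have "UNIV = blinfun_apply (0 :: 'a \<Rightarrow>\<^sub>L real) -` UNIV" by simp
    then show "(\<lambda>x. x) ` topspace (euclidean :: 'a topology) \<subseteq> \<Union> {blinfun_apply \<phi> -` U |(\<phi> :: 'a \<Rightarrow>\<^sub>L real) U. open U}"
      by blast
  qed
  then show ?thesis
    using closedin_continuous_map_preimage[of _ _ _ C] assms by fastforce
qed

lemma weakly_compact_attains_sup:
  fixes \<phi> :: "'a::real_normed_vector \<Rightarrow>\<^sub>L real"
  assumes "compactin weak_topology L" "L \<noteq> {}"
  obtains z where "z \<in> L" "\<And>x. x \<in> L \<Longrightarrow> \<phi> x \<le> \<phi> z"
proof -
  have "compact (blinfun_apply \<phi> ` L)"
    using image_compactin[OF assms(1) continuous_map_weak_topology[of \<phi>]] by simp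
  then show ?thesis
    using compact_attains_sup[of "blinfun_apply \<phi> ` L"] assms(2) that by auto
qed

section \<open>Minimal norming subsets of weakly compact sets\<close>

text \<open>A weakly closed boundary of \<open>L\<close>. A minimal one takes the role that extreme
  points have in the Krein--Milman theorem.\<close>

definition norming_subset :: "'a::real_normed_vector set \<Rightarrow> 'a set \<Rightarrow> bool" where
  "norming_subset L F \<longleftrightarrow> F \<subseteq> L \<and> closedin weak_topology F \<and>
     (\<forall>\<phi> :: 'a \<Rightarrow>\<^sub>L real. \<exists>y\<in>F. \<forall>x\<in>L. \<phi> x \<le> \<phi> y)"

text \<open>Zorn's lemma for reverse inclusion. The intersection of a chain is still norming: for
  each \<open>\<phi>\<close>, the half-space where \<open>\<phi>\<close> is at least its maximum
  over \<open>L\<close> meets every member of the chain, hence all of them at once by weak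
  compactness.\<close>

lemma exists_minimal_norming_subset:
  fixes L :: "'a::real_normed_vector set"
  assumes L: "compactin weak_topology L" "L \<noteq> {}"
  obtains F where "norming_subset L F" "\<And>G. norming_subset L G \<Longrightarrow> G \<subseteq> F \<Longrightarrow> G = F"
proof -
  define A where "A = Collect (norming_subset L)"
  have "\<exists>F\<in>A. \<forall>G\<in>A. F \<supseteq> G \<longrightarrow> G = F"
  proof (rule predicate_Zorn)
    show "partial_order_on A (relation_of (\<supseteq>) A)"
      by (rule partial_order_on_relation_ofI) auto
    fix C assume C: "C \<in> Chains (relation_of (\<supseteq>) A)"
    have CA: "C \<subseteq> A" and cmp: "\<And>F G. F \<in> C \<Longrightarrow> G \<in> C \<Longrightarrow> F \<subseteq> G \<or> G \<subseteq> F"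
      using C by (auto simp: Chains_def relation_of_def)
    show "\<exists>U\<in>A. \<forall>F\<in>C. F \<supseteq> U"
    proof (cases "C = {}")
      case True
      have "norming_subset L L"
        unfolding norming_subset_def
        using weakly_compact_attains_sup[OF L] compactin_imp_closedin[OF Hausdorff_weak_topology L(1)]
        by (metis subset_refl)
      then show ?thesis using True by (auto simp: A_def)
    next
      case False
      have fin: "\<exists>K\<in>C. K \<subseteq> \<Inter>\<F>" if "finite \<F>" "\<F> \<subseteq> C" for \<F>
        using that
      proof (induction rule: finite_induct)
        case (insert X \<F>)
        then obtain K where "K \<in> C" "K \<subseteq> \<Inter>\<F>" by auto
        moreover have "X \<in> C" using insert.prems by simp
        ultimately have "K \<inter> X \<in> C" using cmp[of K X] by (metis inf.absorb1 inf.absorb2)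
        then show ?case using \<open>K \<subseteq> \<Inter>\<F>\<close> by (intro bexI[of _ "K \<inter> X"]) auto
      qed (use False in auto)
      have "\<exists>y\<in>\<Inter>C. \<forall>x\<in>L. \<phi> x \<le> \<phi> y" for \<phi> :: "'a \<Rightarrow>\<^sub>L real"
      proof -
        obtain z where z: "z \<in> L" "\<And>x. x \<in> L \<Longrightarrow> \<phi> x \<le> \<phi> z"
          using weakly_compact_attains_sup[OF L] by metis
        let ?H = "{y. \<phi> z \<le> \<phi> y}"
        have "L \<inter> \<Inter>(insert ?H C) \<noteq> {}"
        proof (rule L(1)[unfolded compactin_fip, THEN conjunct2, rule_format], intro conjI ballI allI impI)
          fix X assume "X \<in> insert ?H C"
          then show "closedin weak_topology X"
            using CA closedin_weak_topology_Collect_ge by (auto simp: A_def norming_subset_def)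
        next
          fix \<F> assume \<F>: "finite \<F> \<and> \<F> \<subseteq> insert ?H C"
          then obtain K where K: "K \<in> C" "K \<subseteq> \<Inter>(\<F> - {?H})"
            using fin[of "\<F> - {?H}"] by auto
          have "norming_subset L K" using CA K(1) by (auto simp: A_def)
          then have "K \<subseteq> L" "\<exists>y\<in>K. \<forall>x\<in>L. \<phi> x \<le> \<phi> y"
            unfolding norming_subset_def by simp_all
          then obtain y where y: "y \<in> K" "\<forall>x\<in>L. \<phi> x \<le> \<phi> y" "y \<in> L"
            by blast
          have "y \<in> X" if "X \<in> \<F>" for X
            using that K(2) z(1) y by (cases "X = ?H") auto
          then show "L \<inter> \<Inter>\<F> \<noteq> {}" using \<open>y \<in> L\<close> by blast
        qed
        then obtain y where "y \<in> \<Inter>C" "\<phi> z \<le> \<phi> y" by auto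
        then show ?thesis using z(2) by (intro bexI[of _ y]) (auto intro: order_trans)
      qed
      moreover have "closedin weak_topology (\<Inter>C)" "\<Inter>C \<subseteq> L"
      proof -
        have "closedin weak_topology F \<and> F \<subseteq> L" if "F \<in> C" for F
          using CA that unfolding A_def norming_subset_def by blast
        then show "closedin weak_topology (\<Inter>C)" "\<Inter>C \<subseteq> L"
          using False by (auto intro: closedin_Inter)
      qed
      ultimately show ?thesis by (intro bexI[of _ "\<Inter>C"]) (auto simp: A_def norming_subset_def)
    qed
  qed
  then show ?thesis using that by (auto simp: A_def)
qed

text \<open>A functional separating a point of \<open>L\<close> from the closed hull would be larger
  there than anywhere on \<open>F\<close>.\<close>

lemma norming_subset_closure_convex_hull:
  fixes L :: "'a::real_normed_vector set"
  assumes "norming_subset L F"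
  shows "L \<subseteq> closure (convex hull F)"
proof
  fix x assume x: "x \<in> L"
  show "x \<in> closure (convex hull F)"
  proof (rule ccontr)
    assume "x \<notin> closure (convex hull F)"
    then obtain \<phi> :: "'a \<Rightarrow>\<^sub>L real" and s where s: "\<And>y. y \<in> closure (convex hull F) \<Longrightarrow> \<phi> y \<le> s" "s < \<phi> x"
      using separation_point_closed_convex[OF closed_closure convex_closure[OF convex_convex_hull]] by metis
    obtain y where "y \<in> F" "\<phi> x \<le> \<phi> y" using assms x unfolding norming_subset_def by blast
    moreover from this have "\<phi> y \<le> s"
      using closure_subset hull_inc by (metis s(1) subsetD)
    ultimately show False using s(2) by simp
  qed
qed

section \<open>Dentability of weakly compact sets\<close>

text \<open>By Baire, some ball meets the minimal norming set \<open>F\<close> in a set with relative weak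
  interior \<open>W \<noteq> {}\<close>, and by minimality some functional \<open>\<phi>\<close> stays on \<open>F - W\<close> below a
  constant smaller than its maximum \<open>\<phi> z\<close> over \<open>L\<close>.  The points \<open>x\<close> whose distance to
  the ball is at most a fixed multiple of \<open>\<phi> z - \<phi> x\<close> form a convex set containing
  \<open>F\<close>, so the thin slices of \<open>L\<close> given by \<open>\<phi>\<close> stay close to the ball.\<close>

lemma weakly_compact_small_slice:
  fixes L :: "'a::real_normed_vector set" and \<psi> :: "'a \<Rightarrow>\<^sub>L real"
  assumes L: "compactin weak_topology L" and bd: "\<And>x. x \<in> L \<Longrightarrow> norm x \<le> R"
    and sep: "\<And>r. r > 0 \<Longrightarrow> \<exists>N. countable N \<and> L \<subseteq> (\<Union>c\<in>N. cball c r)"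
    and x0: "x0 \<in> L" "t < \<psi> x0" and e: "e > 0"
  obtains \<phi> :: "'a \<Rightarrow>\<^sub>L real" and s c z where "z \<in> L" "s < \<phi> z"
    "\<And>x. x \<in> L \<Longrightarrow> s < \<phi> x \<Longrightarrow> x \<in> cball c e \<and> t < \<psi> x"
proof -
  \<comment> \<open>The intermediate level leaves room for moving from a point with
    \<open>\<psi>\<close> at least \<open>t'\<close> to a nearby one that still satisfies
    \<open>t < \<psi> x\<close>.\<close>
  define t' where "t' = (t + \<psi> x0) / 2"
  have t': "t < t'" "t' < \<psi> x0" using x0 by (auto simp: t'_def)
  have Lne: "L \<noteq> {}" using x0 by blast
  obtain F where F: "norming_subset L F" and min: "\<And>G. norming_subset L G \<Longrightarrow> G \<subseteq> F \<Longrightarrow> G = F"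
    using exists_minimal_norming_subset[OF L Lne] by blast
  have FL: "F \<subseteq> L" and Fcl: "closedin weak_topology F" and Fn: "\<And>\<phi> :: 'a \<Rightarrow>\<^sub>L real. \<exists>y\<in>F. \<forall>x\<in>L. \<phi> x \<le> \<phi> y"
    using F by (auto simp: norming_subset_def)
  let ?X = "subtopology weak_topology F"
  obtain N where N: "countable N" "L \<subseteq> (\<Union>c\<in>N. cball c (e / 2))" using sep[of "e / 2"] e by auto
  define H where "H c = cball c (e / 2) \<inter> {x. t' \<le> \<psi> x}" for c
  have Hcl: "closedin weak_topology (H c)" and Hconv: "convex (H c)" for c
    unfolding H_def
    by (intro closedin_Int closedin_weak_topology_convex closedin_weak_topology_Collect_ge
      convex_Int convex_Collect_ge_blinfun closed_cball convex_cball)+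
  \<comment> \<open>The countably many closed pieces \<open>F \<inter> H c\<close> cover the
    relatively open part of \<open>F\<close> where \<open>t' < \<psi> x\<close>. This part is
    non-empty because \<open>\<psi>\<close> attains its maximum over \<open>L\<close> on
    \<open>F\<close>.\<close>
  have "\<exists>c\<in>N. ?X interior_of (F \<inter> H c) \<noteq> {}"
  proof (rule ccontr)
    assume *: "\<not> (\<exists>c\<in>N. ?X interior_of (F \<inter> H c) \<noteq> {})"
    have comp: "compact_space ?X"
      using closed_compactin[OF L FL Fcl] by (simp add: compact_space_subtopology)
    have "?X interior_of (\<Union>c\<in>N. F \<inter> H c) = {}"
    proof (rule Baire_category_alt)
      show "completely_metrizable_space ?X \<or> locally_compact_space ?X \<and> regular_space ?X"
        using comp by (simp add: compact_imp_locally_compact_space compact_Hausdorff_imp_regular_space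
            Hausdorff_space_subtopology Hausdorff_weak_topology)
      show "closedin ?X S \<and> ?X interior_of S = {}" if "S \<in> (\<lambda>c. F \<inter> H c) ` N" for S
        using that * Hcl by (auto simp: closedin_subtopology)
    qed (use N in auto)
    moreover have "openin ?X (F \<inter> {x. t' < \<psi> x})"
      using openin_weak_topology_Collect_less by (auto simp: openin_subtopology)
    moreover have "F \<inter> {x. t' < \<psi> x} \<subseteq> (\<Union>c\<in>N. F \<inter> H c)"
      using N(2) FL by (fastforce simp: H_def)
    ultimately have "F \<inter> {x. t' < \<psi> x} = {}"
      by (metis interior_of_maximal subset_empty)
    then show False using Fn[of \<psi>] x0(1) t'(2) by force
  qed
  then obtain c where c: "?X interior_of (F \<inter> H c) \<noteq> {}" by blast
  define W where "W = ?X interior_of (F \<inter> H c)"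
  have W: "openin ?X W" "W \<noteq> {}" "W \<subseteq> F" "W \<subseteq> H c"
    using c interior_of_subset[of ?X "F \<inter> H c"] by (auto simp: W_def)
  have FW: "closedin weak_topology (F - W)"
  proof -
    have "closedin ?X (F - W)" using closedin_diff[OF closedin_topspace W(1)] by simp
    then show ?thesis using Fcl by (rule closedin_trans_full)
  qed
  have "\<not> norming_subset L (F - W)" using min[of "F - W"] W by auto
  then obtain \<phi> :: "'a \<Rightarrow>\<^sub>L real" where \<phi>: "\<And>y. y \<in> F - W \<Longrightarrow> \<exists>x\<in>L. \<phi> y < \<phi> x"
    using FW FL unfolding norming_subset_def by (metis DiffD1 in_mono linorder_not_less subsetI)
  obtain z where z: "z \<in> L" "\<And>x. x \<in> L \<Longrightarrow> \<phi> x \<le> \<phi> z"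
    using weakly_compact_attains_sup[OF L Lne] by metis
  \<comment> \<open>On the weakly compact set \<open>F - W\<close> the functional
    \<open>\<phi>\<close> attains its maximum, so the strict inequalities at single points become
    one uniform gap; if the set is empty, any number below \<open>\<phi> z\<close> will do.\<close>
  obtain m where m: "m < \<phi> z" "\<And>y. y \<in> F - W \<Longrightarrow> \<phi> y \<le> m"
  proof (cases "F - W = {}")
    case False
    have "compactin weak_topology (F - W)"
      using closed_compactin[OF L _ FW] FL by blast
    then obtain y where y: "y \<in> F - W" "\<And>x. x \<in> F - W \<Longrightarrow> \<phi> x \<le> \<phi> y"
      using weakly_compact_attains_sup[OF _ False] by metis
    show ?thesis
      by (rule that[of "\<phi> y"]) (use y \<phi>[OF y(1)] z in \<open>auto intro: less_le_trans\<close>)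
  qed (use that[of "\<phi> z - 1"] in auto)
  obtain w where w: "w \<in> W" using W by blast
  have "0 \<le> norm x0" by simp
  then have R: "R \<ge> 0" using bd[OF x0(1)] by linarith
  \<comment> \<open>Chosen so that \<open>\<kappa> * (\<phi> z - \<phi> y)\<close> is at least
    \<open>2 * R + 1\<close> on \<open>F - W\<close>, which exceeds the distance from
    \<open>y\<close> to the fixed point \<open>w\<close> of \<open>W\<close>. The summand
    \<open>1\<close> keeps \<open>\<kappa>\<close> positive when \<open>R = 0\<close>.\<close>
  define \<kappa> where "\<kappa> = (2 * R + 1) / (\<phi> z - m)"
  have \<kappa>: "\<kappa> > 0" using m R by (simp add: \<kappa>_def)
  define E where "E = {x. \<exists>b\<in>H c. norm (x - b) \<le> \<kappa> * (\<phi> z - \<phi> x)}"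
  have "convex E"
    unfolding convex_def
  proof (intro ballI allI impI)
    fix x y and u v :: real assume xy: "x \<in> E" "y \<in> E" and uv: "0 \<le> u" "0 \<le> v" "u + v = 1"
    then obtain a b where a: "a \<in> H c" "norm (x - a) \<le> \<kappa> * (\<phi> z - \<phi> x)"
      and b: "b \<in> H c" "norm (y - b) \<le> \<kappa> * (\<phi> z - \<phi> y)" by (auto simp: E_def)
    have "norm (u *\<^sub>R x + v *\<^sub>R y - (u *\<^sub>R a + v *\<^sub>R b)) \<le> u * norm (x - a) + v * norm (y - b)"
    proof -
      have "u *\<^sub>R x + v *\<^sub>R y - (u *\<^sub>R a + v *\<^sub>R b) = u *\<^sub>R (x - a) + v *\<^sub>R (y - b)"
        by (simp add: algebra_simps)
      then show ?thesis
        using norm_triangle_ineq[of "u *\<^sub>R (x - a)" "v *\<^sub>R (y - b)"] uv by simp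
    qed
    also have "\<dots> \<le> u * (\<kappa> * (\<phi> z - \<phi> x)) + v * (\<kappa> * (\<phi> z - \<phi> y))"
      using a b uv by (intro add_mono mult_left_mono) auto
    also have "\<dots> = \<kappa> * ((u + v) * \<phi> z - (u * \<phi> x + v * \<phi> y))" by (simp add: algebra_simps)
    finally have "norm (u *\<^sub>R x + v *\<^sub>R y - (u *\<^sub>R a + v *\<^sub>R b)) \<le> \<kappa> * (\<phi> z - \<phi> (u *\<^sub>R x + v *\<^sub>R y))"
      using uv by (simp add: blinfun.add_right blinfun.scaleR_right)
    moreover have "u *\<^sub>R a + v *\<^sub>R b \<in> H c" using Hconv a b uv by (auto simp: convex_def)
    ultimately show "u *\<^sub>R x + v *\<^sub>R y \<in> E" by (auto simp: E_def)
  qed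
  moreover have "F \<subseteq> E"
  proof
    fix y assume y: "y \<in> F"
    show "y \<in> E"
    proof (cases "y \<in> W")
      case True
      then show ?thesis using W(4) z y FL \<kappa> by (auto simp: E_def intro!: bexI[of _ y])
    next
      case False
      have "norm (y - w) \<le> 2 * R + 1"
        using norm_triangle_ineq4[of y w] bd[of y] bd[of w] y w FL W by force
      also have "\<dots> = \<kappa> * (\<phi> z - m)" using m by (simp add: \<kappa>_def)
      also have "\<dots> \<le> \<kappa> * (\<phi> z - \<phi> y)" using m(2)[of y] False y \<kappa> by simp
      finally show ?thesis using w W by (auto simp: E_def)
    qed
  qed
  ultimately have FE: "convex hull F \<subseteq> E" by (simp add: hull_minimal)
  \<comment> \<open>The first bound enlarges the radius \<open>e / 2\<close> of \<open>H c\<close>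
    to at most \<open>e\<close>; the second keeps the loss in \<open>\<psi>\<close> below
    \<open>t' - t\<close>, with \<open>1\<close> added against a vanishing norm.\<close>
  define \<eta> where "\<eta> = min (e / 2) ((t' - t) / (norm \<psi> + 1))"
  have \<eta>: "\<eta> > 0" "\<eta> \<le> e / 2" "norm \<psi> * \<eta> < t' - t"
  proof -
    have p: "norm \<psi> + 1 > 0" by (simp add: add_nonneg_pos)
    show pos: "\<eta> > 0" using e t' p by (simp add: \<eta>_def)
    show "\<eta> \<le> e / 2" unfolding \<eta>_def by (rule min.cobounded1)
    have "\<eta> \<le> (t' - t) / (norm \<psi> + 1)" unfolding \<eta>_def by (rule min.cobounded2)
    then have "(norm \<psi> + 1) * \<eta> \<le> t' - t" using p by (simp add: field_simps)
    then show "norm \<psi> * \<eta> < t' - t" using pos by (simp add: algebra_simps)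
  qed
  \<comment> \<open>The points of \<open>L\<close> lie only in the closure of the hull of
    \<open>F\<close>: half of \<open>\<eta>\<close> pays for approximating \<open>x\<close> by
    \<open>y\<close> in the hull, the other half bounds the distance from \<open>y\<close> to a
    point of \<open>H c\<close>.\<close>
  define s where "s = \<phi> z - \<eta> / (2 * \<kappa>)"
  show ?thesis
  proof (rule that[of z s \<phi> c])
    show "z \<in> L" by (rule z)
    show "s < \<phi> z" using \<eta> \<kappa> by (simp add: s_def)
    fix x assume x: "x \<in> L" "s < \<phi> x"
    have "open ({y. s < \<phi> y} \<inter> ball x (\<eta> / 2))"
      by (intro open_Int open_ball open_Collect_less continuous_intros)
    moreover have "x \<in> {y. s < \<phi> y} \<inter> ball x (\<eta> / 2)" using x \<eta> by simp
    ultimately have "({y. s < \<phi> y} \<inter> ball x (\<eta> / 2)) \<inter> convex hull F \<noteq> {}"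
      using norming_subset_closure_convex_hull[OF F] x(1) open_Int_closure_eq_empty by blast
    then obtain y where y: "y \<in> convex hull F" "s < \<phi> y" "dist x y < \<eta> / 2" by auto
    then obtain b where b: "b \<in> H c" "norm (y - b) \<le> \<kappa> * (\<phi> z - \<phi> y)" using FE by (auto simp: E_def)
    have "\<kappa> * (\<phi> z - \<phi> y) \<le> \<kappa> * (\<eta> / (2 * \<kappa>))" using y(2) \<kappa> by (intro mult_left_mono) (auto simp: s_def)
    then have "norm (y - b) \<le> \<eta> / 2" using b(2) \<kappa> by simp
    then have xb: "norm (x - b) \<le> \<eta>"
      using y(3) norm_triangle_ineq[of "x - y" "y - b"] by (simp add: dist_norm)
    have "dist c x \<le> dist c b + norm (x - b)" by (metis dist_commute dist_norm dist_triangle)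
    then have "x \<in> cball c e" using b(1) xb \<eta>(2) by (simp add: H_def)
    moreover have "\<psi> b - \<psi> x \<le> norm \<psi> * \<eta>"
    proof -
      have "\<psi> b - \<psi> x \<le> norm (\<psi> (x - b))" by (simp add: blinfun.diff_right)
      also have "\<dots> \<le> norm \<psi> * norm (x - b)" by (rule norm_blinfun)
      also have "\<dots> \<le> norm \<psi> * \<eta>" using xb by (simp add: mult_left_mono)
      finally show ?thesis .
    qed
    then have "t < \<psi> x" using b(1) \<eta>(3) by (simp add: H_def)
    ultimately show "x \<in> cball c e \<and> t < \<psi> x" ..
  qed
qed

section \<open>Reduction to separable sets and dentability\<close>

lemma in_convex_hull_finite_subset:
  assumes "x \<in> convex hull S"
  obtains T where "finite T" "T \<subseteq> S" "x \<in> convex hull T"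
proof -
  from assms obtain T u where "finite T" "T \<subseteq> S" "\<forall>x\<in>T. 0 \<le> u x" "sum u T = 1" "(\<Sum>v\<in>T. u v *\<^sub>R v) = x"
    by (auto simp: convex_hull_explicit)
  then show ?thesis by (intro that[of T]) (auto simp: convex_hull_explicit intro!: exI[of _ T] exI[of _ u])
qed

lemma in_closure_convex_hull_countable_subset:
  fixes S :: "'a::real_normed_vector set"
  assumes "x \<in> closure (convex hull S)"
  shows "\<exists>T. countable T \<and> T \<subseteq> S \<and> x \<in> closure (convex hull T)"
proof -
  obtain y where y: "\<And>n. y n \<in> convex hull S" "y \<longlonglongrightarrow> x"
    using assms by (auto simp: closure_sequential)
  have "\<exists>T. finite T \<and> T \<subseteq> S \<and> y n \<in> convex hull T" for n
    using in_convex_hull_finite_subset[OF y(1)] by metis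
  then obtain T where T: "\<And>n. finite (T n)" "\<And>n. T n \<subseteq> S" "\<And>n. y n \<in> convex hull (T n)" by metis
  have "y n \<in> convex hull (\<Union>n. T n)" for n
    using T(3)[of n] hull_mono[of "T n" "\<Union>n. T n" convex] by blast
  then have "x \<in> closure (convex hull (\<Union>n. T n))"
    using y(2) by (auto simp: closure_sequential)
  then show ?thesis using T by (intro exI[of _ "\<Union>n. T n"]) (auto intro: countable_finite)
qed

text \<open>The hulls of the countably many finite subsets of \<open>A\<close> are compact, hence
  totally bounded. Covers by countably many small balls are the form of separability that the Baire
  argument uses.\<close>

lemma closure_convex_hull_countable_separable:
  fixes A :: "'a::real_normed_vector set"
  assumes "countable A" "r > 0"
  shows "\<exists>N. countable N \<and> closure (convex hull A) \<subseteq> (\<Union>c\<in>N. cball c r)"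
proof -
  have "\<exists>N. finite N \<and> convex hull T \<subseteq> (\<Union>c\<in>N. ball c (r / 2))" if "finite T" for T :: "'a set"
    using finite_imp_compact_convex_hull[OF that] assms(2) unfolding compact_eq_totally_bounded
    by (meson half_gt_zero)
  then obtain N where N: "\<And>T :: 'a set. finite T \<Longrightarrow> finite (N T) \<and> convex hull T \<subseteq> (\<Union>c\<in>N T. ball c (r / 2))"
    by metis
  let ?N = "\<Union>T\<in>{T. finite T \<and> T \<subseteq> A}. N T"
  have "countable ?N"
    using N countable_Collect_finite_subset[OF assms(1)] by (auto intro: countable_finite)
  moreover have "closure (convex hull A) \<subseteq> (\<Union>c\<in>?N. cball c r)"
  proof
    fix x assume "x \<in> closure (convex hull A)"
    then obtain y where y: "y \<in> convex hull A" "dist y x < r / 2"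
      using assms(2) by (metis closure_approachable half_gt_zero)
    then obtain T where T: "finite T" "T \<subseteq> A" "y \<in> convex hull T"
      using in_convex_hull_finite_subset by metis
    then obtain c where "c \<in> N T" "dist c y < r / 2" using N[OF T(1)] by auto
    then show "x \<in> (\<Union>c\<in>?N. cball c r)"
      using y(2) T dist_triangle[of c x y] by (auto intro!: bexI[of _ T] bexI[of _ c])
  qed
  ultimately show ?thesis by blast
qed

text \<open>If the conclusion failed, a countable set \<open>A \<subseteq> K\<close> could be closed up under the choice of
  far away points averaging to a given one, so that the separable weakly compact set
  \<open>closure (convex hull A)\<close> would have no small slice inside \<open>{x. t < \<psi> x}\<close>.\<close>

lemma weakly_relatively_compact_dentable:
  fixes K :: "'a::real_normed_vector set" and \<psi> :: "'a \<Rightarrow>\<^sub>L real"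
  assumes K: "convex K" "\<And>x. x \<in> K \<Longrightarrow> norm x \<le> R" "compactin weak_topology (weak_topology closure_of K)"
    and x0: "x0 \<in> K" "t < \<psi> x0" and e: "e > 0"
  shows "\<exists>x\<in>K. t < \<psi> x \<and> x \<notin> closure (convex hull (K - cball x e))"
proof (rule ccontr)
  assume neg: "\<not> ?thesis"
  have "\<exists>T. countable T \<and> T \<subseteq> K - cball x e \<and> x \<in> closure (convex hull T)" if "x \<in> K" "t < \<psi> x" for x
    using neg that in_closure_convex_hull_countable_subset by metis
  then obtain C where C: "\<And>x. x \<in> K \<Longrightarrow> t < \<psi> x \<Longrightarrow> countable (C x)"
      "\<And>x. x \<in> K \<Longrightarrow> t < \<psi> x \<Longrightarrow> C x \<subseteq> K - cball x e"
      "\<And>x. x \<in> K \<Longrightarrow> t < \<psi> x \<Longrightarrow> x \<in> closure (convex hull C x)" by metis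
  define B where "B = rec_nat {x0} (\<lambda>n S. S \<union> (\<Union>x\<in>S \<inter> {x. t < \<psi> x}. C x))"
  have B0: "B 0 = {x0}" and BS: "\<And>n. B (Suc n) = B n \<union> (\<Union>x\<in>B n \<inter> {x. t < \<psi> x}. C x)"
    by (simp_all add: B_def)
  have BK: "B n \<subseteq> K \<and> countable (B n)" for n
  proof (induction n)
    case (Suc n)
    have "C x \<subseteq> K \<and> countable (C x)" if "x \<in> B n \<inter> {x. t < \<psi> x}" for x
      using that Suc C(1,2)[of x] by blast
    moreover from Suc have "countable (B n \<inter> {x. t < \<psi> x})" by simp
    ultimately show ?case using Suc unfolding BS by (intro conjI countable_Un countable_UN) auto
  qed (use x0 in \<open>simp add: B0\<close>)
  define A where "A = (\<Union>n. B n)"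
  have A: "countable A" "A \<subseteq> K" "x0 \<in> A"
    using BK B0 by (auto simp: A_def)
  have AC: "C a \<subseteq> A" if "a \<in> A" "t < \<psi> a" for a
    using that BS by (fastforce simp: A_def)
  define L where "L = closure (convex hull A)"
  have AL: "A \<subseteq> L" unfolding L_def using closure_subset hull_subset by (metis order_trans)
  \<comment> \<open>Weakly closed sets are norm closed, so the norm closure \<open>L\<close> stays
    inside the weakly compact closure of \<open>K\<close>; being convex, \<open>L\<close> is weakly
    closed in it.\<close>
  have "closed (weak_topology closure_of K)"
    by (intro closedin_weak_imp_closed closedin_closure_of)
  moreover have "convex hull A \<subseteq> weak_topology closure_of K"
    using A(2) K(1) closure_of_subset[of K weak_topology] hull_minimal[of A K convex] by auto
  ultimately have "L \<subseteq> weak_topology closure_of K"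
    unfolding L_def by (simp add: closure_minimal)
  then have Lc: "compactin weak_topology L"
    by (rule closed_compactin[OF K(3)]) (auto simp: L_def intro!: closedin_weak_topology_convex convex_closure)
  have "convex hull A \<subseteq> cball 0 R"
    using A(2) K(2) by (intro hull_minimal) auto
  then have Lb: "L \<subseteq> cball 0 R"
    unfolding L_def by (simp add: closure_minimal)
  \<comment> \<open>With radius \<open>e / 2\<close> any two points of the slice are at distance at
    most \<open>e\<close>, whereas the points of \<open>C a\<close> are farther than
    \<open>e\<close> from \<open>a\<close>.\<close>
  obtain \<phi> :: "'a \<Rightarrow>\<^sub>L real" and s c z where z: "z \<in> L" "s < \<phi> z"
    and sl: "\<And>x. x \<in> L \<Longrightarrow> s < \<phi> x \<Longrightarrow> x \<in> cball c (e / 2) \<and> t < \<psi> x"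
  proof (rule weakly_compact_small_slice[OF Lc])
    show "norm x \<le> R" if "x \<in> L" for x using Lb that by auto
    show "\<exists>N. countable N \<and> L \<subseteq> (\<Union>c\<in>N. cball c r)" if "r > 0" for r
      unfolding L_def using closure_convex_hull_countable_separable[OF A(1) that] .
    show "x0 \<in> L" using A AL by blast
    show "t < \<psi> x0" "e / 2 > 0" using x0 e by auto
  qed blast
  have half: "closure (convex hull S) \<subseteq> {x. \<phi> x \<le> s}" if "S \<subseteq> {x. \<phi> x \<le> s}" for S
  proof (intro closure_minimal hull_minimal that)
    show "convex {x. \<phi> x \<le> s}"
      using convex_Collect_ge_blinfun[of "- s" "- \<phi>"] by (simp add: uminus_blinfun.rep_eq)
    show "closed {x. \<phi> x \<le> s}" by (intro closed_Collect_le continuous_intros)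
  qed
  have "\<not> A \<subseteq> {x. \<phi> x \<le> s}" using half[of A] z unfolding L_def by force
  then obtain a where a: "a \<in> A" "s < \<phi> a" by force
  have a': "a \<in> cball c (e / 2)" "t < \<psi> a" "a \<in> K" using sl[of a] a A AL by auto
  \<comment> \<open>All of \<open>C a\<close> misses the slice, hence so does the closed hull of
    \<open>C a\<close>, although it contains the point \<open>a\<close> of the slice.\<close>
  have "C a \<subseteq> {x. \<phi> x \<le> s}"
  proof
    fix y assume y: "y \<in> C a"
    then have "e < dist a y" "y \<in> L" using C(2)[OF a'(3,2)] AC[OF a(1) a'(2)] AL by auto
    moreover have "dist a y \<le> dist c a + dist c y" by (metis dist_commute dist_triangle)
    ultimately have "y \<notin> cball c (e / 2)" using a'(1) by auto
    then show "y \<in> {x. \<phi> x \<le> s}" using sl[OF \<open>y \<in> L\<close>] by force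
  qed
  then have "closure (convex hull C a) \<subseteq> {x. \<phi> x \<le> s}" by (rule half)
  then show False using C(3)[OF a'(3,2)] a(2) by (metis linorder_not_less mem_Collect_eq subsetD)
qed

section \<open>Slices of the unit ball with small image\<close>

lemma norm_blinfun_less_imp_ex:
  assumes "r < norm T" "0 \<le> r"
  obtains x where "norm x \<le> 1" "r < norm (blinfun_apply T x)"
proof -
  have "\<exists>x. \<not> norm (T x) \<le> r * norm x"
    using assms norm_blinfun_bound[of r T] by force
  then obtain x where x: "r * norm x < norm (T x)" by (auto simp: not_le)
  then have "x \<noteq> 0" by (auto simp: blinfun.zero_right)
  with x show ?thesis
    by (intro that[of "inverse (norm x) *\<^sub>R x"]) (auto simp: blinfun.scaleR_right field_simps)
qed

text \<open>Dentability of the image \<open>K\<close> of the unit ball gives a point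
  \<open>x\<close> with \<open>t < \<psi> x\<close>, hence of norm above \<open>t\<close>, and a
  functional \<open>\<phi>\<close> whose slice of \<open>K\<close> at \<open>x\<close> lies within
  \<open>e\<close> of \<open>x\<close>. Composing \<open>\<phi>\<close> with \<open>T\<close> and
  normalising yields \<open>g\<close>.\<close>

lemma weakly_compact_operator_slice:
  fixes T :: "'a::real_normed_vector \<Rightarrow>\<^sub>L 'b::real_normed_vector"
  assumes T: "weakly_compact_operator T" and t: "0 < t" "t < norm T" and e: "0 < e" "e \<le> t"
  obtains g :: "'a \<Rightarrow>\<^sub>L real" and x s where "norm g = 1" "s < 1" "t < norm x" "norm x \<le> norm T"
    "\<And>f. norm f \<le> 1 \<Longrightarrow> s < g f \<Longrightarrow> norm (T f - x) \<le> e"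
proof -
  define K where "K = blinfun_apply T ` cball 0 1"
  have K: "convex K" "\<And>x. x \<in> K \<Longrightarrow> norm x \<le> norm T" "compactin weak_topology (weak_topology closure_of K)"
  proof -
    show "convex K" unfolding K_def
      by (intro convex_linear_image bounded_linear.linear blinfun.bounded_linear_right convex_cball)
    show "norm x \<le> norm T" if "x \<in> K" for x
      using that norm_blinfun[of T] by (fastforce simp: K_def intro: order_trans mult_left_le)
    show "compactin weak_topology (weak_topology closure_of K)"
      using T by (simp add: K_def weakly_compact_operator_def)
  qed
  obtain f0 where "norm f0 \<le> 1" "t < norm (T f0)" using norm_blinfun_less_imp_ex[of t T] t by auto
  moreover from this obtain \<psi> :: "'b \<Rightarrow>\<^sub>L real" where \<psi>: "norm \<psi> \<le> 1" "t < \<psi> (T f0)"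
    using norming_functional[of t "T f0"] t by auto
  ultimately obtain x where x: "x \<in> K" "t < \<psi> x" "x \<notin> closure (convex hull (K - cball x e))"
    using weakly_relatively_compact_dentable[OF K, of "T f0" t \<psi> e] e by (auto simp: K_def)
  have "\<psi> x \<le> norm \<psi> * norm x" using norm_blinfun[of \<psi> x] by simp
  also have "\<dots> \<le> norm x" using \<psi>(1) by (simp add: mult_left_le_one_le)
  finally have tx: "t < norm x" using x by simp
  obtain \<phi> :: "'b \<Rightarrow>\<^sub>L real" and s where \<phi>: "\<And>y. y \<in> closure (convex hull (K - cball x e)) \<Longrightarrow> \<phi> y \<le> s" "s < \<phi> x"
    using separation_point_closed_convex[OF closed_closure convex_closure[OF convex_convex_hull] x(3)] by metis
  have sl: "norm (y - x) \<le> e" if "y \<in> K" "s < \<phi> y" for y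
  proof (rule ccontr)
    assume "\<not> norm (y - x) \<le> e"
    then have "y \<in> K - cball x e" using that by (auto simp: dist_norm norm_minus_commute)
    then have "\<phi> y \<le> s" using \<phi>(1) closure_subset hull_subset by (metis subsetD)
    then show False using that by simp
  qed
  define g where "g = \<phi> o\<^sub>L T"
  have g: "g f = \<phi> (T f)" for f by (simp add: g_def)
  obtain f1 where f1: "norm f1 \<le> 1" "x = T f1" using x by (auto simp: K_def)
  \<comment> \<open>If \<open>\<phi>\<close> vanished on \<open>K\<close>, the slice would contain
    \<open>0\<close>, so that \<open>norm x \<le> e \<le> t\<close>; this is the purpose of
    \<open>e \<le> t\<close>.\<close>
  have "g \<noteq> 0"
  proof
    assume "g = 0"
    then have zero: "\<phi> (T f) = 0" for f using g[of f] by simp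
    have "T 0 \<in> K" unfolding K_def by (rule imageI) simp
    moreover have "s < \<phi> (T 0)" using \<phi>(2) zero[of f1] zero[of 0] f1(2) by simp
    ultimately have "norm (T 0 - x) \<le> e" by (rule sl)
    then show False using tx e(2) by (simp add: blinfun.zero_right)
  qed
  then have pos: "norm g > 0" by simp
  show ?thesis
  proof (rule that[of "inverse (norm g) *\<^sub>R g" "s / norm g" x])
    have "s < norm g * norm f1" using \<phi>(2) norm_blinfun[of g f1] g[of f1] f1 by simp
    also have "\<dots> \<le> norm g" using f1 by (simp add: mult_left_le)
    finally show "s / norm g < 1" using pos by simp
    fix f :: 'a assume "norm f \<le> 1" "s / norm g < (inverse (norm g) *\<^sub>R g) f"
    then show "norm (T f - x) \<le> e"
      using pos g by (intro sl) (auto simp: K_def blinfun.scaleR_left field_simps)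
  qed (use pos tx K(2)[OF x(1)] in auto)
qed

section \<open>Reflexivity\<close>

text \<open>The Banach--Alaoglu argument in the bidual: by Tychonoff the set \<open>H\<close> of
  linear functionals on the dual dominated by the norm is compact for pointwise convergence. By
  reflexivity each is the evaluation at some \<open>F h\<close>, and \<open>F\<close> maps
  \<open>H\<close> onto the unit ball, continuously for the weak topology.\<close>

lemma reflexive_imp_weakly_compact_cball:
  assumes "reflexive_space TYPE('x::real_normed_vector)"
  shows "compactin weak_topology (cball 0 1 :: 'x set)"
proof -
  define P where "P = (\<Pi>\<^sub>E \<phi>\<in>(UNIV :: ('x \<Rightarrow>\<^sub>L real) set). {- norm \<phi>..norm \<phi>})"
  define H where "H = P \<inter> {h. (\<forall>\<phi> \<psi>. h (\<phi> + \<psi>) = h \<phi> + h \<psi>) \<and> (\<forall>c \<phi>. h (c *\<^sub>R \<phi>) = c * h \<phi>)}"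
  have "compactin (product_topology (\<lambda>_. euclideanreal) UNIV) P"
    unfolding P_def compactin_PiE by simp
  then have "compact P" by (simp add: euclidean_product_topology)
  moreover have "closed {h :: ('x \<Rightarrow>\<^sub>L real) \<Rightarrow> real.
      (\<forall>\<phi> \<psi>. h (\<phi> + \<psi>) = h \<phi> + h \<psi>) \<and> (\<forall>c \<phi>. h (c *\<^sub>R \<phi>) = c * h \<phi>)}"
    by (intro closed_Collect_conj closed_Collect_all closed_Collect_eq continuous_intros
        continuous_on_product_coordinates)
  ultimately have H: "compact H" unfolding H_def by (rule compact_Int_closed)
  have bnd: "\<bar>h \<phi>\<bar> \<le> norm \<phi>" if "h \<in> H" for h \<phi>
  proof -
    have "h \<in> P" using that by (simp add: H_def)
    then have "h \<phi> \<in> {- norm \<phi>..norm \<phi>}" unfolding P_def by (rule PiE_mem) simp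
    then show ?thesis by (auto simp: abs_le_iff)
  qed
  have "\<exists>x :: 'x. \<forall>\<phi>. h \<phi> = \<phi> x" if "h \<in> H" for h
  proof -
    have "bounded_linear h"
    proof (rule bounded_linear_intro)
      show "norm (h \<phi>) \<le> norm \<phi> * 1" for \<phi> using bnd[OF that] by simp
    qed (use that in \<open>auto simp: H_def\<close>)
    moreover obtain x :: 'x where "bidual_embedding x = Blinfun h"
      using assms unfolding reflexive_space_def by (metis surjE)
    ultimately show ?thesis by (metis bidual_embedding.rep_eq bounded_linear_Blinfun_apply)
  qed
  then obtain F :: "(('x \<Rightarrow>\<^sub>L real) \<Rightarrow> real) \<Rightarrow> 'x" where F: "\<And>h \<phi>. h \<in> H \<Longrightarrow> h \<phi> = \<phi> (F h)" by metis
  have "F ` H = cball 0 1"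
  proof (intro equalityI subsetI)
    fix x assume "x \<in> F ` H"
    then obtain h where h: "h \<in> H" "x = F h" by blast
    have "\<not> 1 < norm x"
    proof
      assume "1 < norm x"
      then obtain \<phi> :: "'x \<Rightarrow>\<^sub>L real" where "norm \<phi> \<le> 1" "1 < \<phi> x" using norming_functional[of 1 x] by auto
      moreover have "\<phi> x \<le> norm \<phi>" using F[OF h(1), of \<phi>] h bnd[OF h(1), of \<phi>] by simp
      ultimately show False by simp
    qed
    then show "x \<in> cball 0 1" by simp
  next
    fix x :: 'x assume x: "x \<in> cball 0 1"
    define h where "h = (\<lambda>\<phi> :: 'x \<Rightarrow>\<^sub>L real. \<phi> x)"
    have "\<bar>\<phi> x\<bar> \<le> norm \<phi>" for \<phi> :: "'x \<Rightarrow>\<^sub>L real"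
      using norm_blinfun[of \<phi> x] mult_left_le[of "norm x" "norm \<phi>"] x by simp
    then have h: "h \<in> H"
      by (auto simp: H_def P_def h_def abs_le_iff blinfun.add_left blinfun.scaleR_left minus_le_iff)
    have "F h = x"
    proof (rule ccontr)
      assume "F h \<noteq> x"
      then obtain \<phi> :: "'x \<Rightarrow>\<^sub>L real" where "0 < \<phi> (F h - x)"
        using norming_functional[of 0 "F h - x"] by auto
      then show False using F[OF h, of \<phi>] by (simp add: h_def blinfun.diff_right)
    qed
    then show "x \<in> F ` H" using h by blast
  qed
  moreover have "continuous_map (top_of_set H) weak_topology F"
    unfolding weak_topology_def
  proof (rule continuous_on_generated_topo)
    fix V assume "V \<in> {blinfun_apply \<phi> -` U |(\<phi> :: 'x \<Rightarrow>\<^sub>L real) U. open U}"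
    then obtain \<phi> :: "'x \<Rightarrow>\<^sub>L real" and U where V: "V = blinfun_apply \<phi> -` U" "open U" by blast
    have "F -` V \<inter> H = H \<inter> (\<lambda>h. h \<phi>) -` U" using F by (auto simp: V)
    then show "openin (top_of_set H) (F -` V \<inter> topspace (top_of_set H))"
      using open_vimage[OF V(2) continuous_on_product_coordinates[of \<phi>]] by (simp add: openin_open_Int)
  next
    have "UNIV = blinfun_apply (0 :: 'x \<Rightarrow>\<^sub>L real) -` UNIV" by simp
    then show "F ` topspace (top_of_set H) \<subseteq> \<Union> {blinfun_apply \<phi> -` U |(\<phi> :: 'x \<Rightarrow>\<^sub>L real) U. open U}"
      by blast
  qed
  ultimately show ?thesis
    using image_compactin[of "top_of_set H" H weak_topology F] H by (simp add: compactin_subtopology)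
qed

lemma reflexive_imp_weakly_compact_uminus:
  assumes "reflexive_space TYPE('x::real_normed_vector)"
  shows "weakly_compact_operator (- id_blinfun :: 'x \<Rightarrow>\<^sub>L 'x)"
proof -
  have "blinfun_apply (- id_blinfun :: 'x \<Rightarrow>\<^sub>L 'x) ` cball 0 1 = cball 0 1"
    by (auto simp: uminus_blinfun.rep_eq image_iff intro!: bexI[of _ "- _"])
  moreover have "closedin weak_topology (cball 0 1 :: 'x set)"
    by (intro closedin_weak_topology_convex closed_cball convex_cball)
  ultimately show ?thesis
    using reflexive_imp_weakly_compact_cball[OF assms] by (simp add: weakly_compact_operator_def closure_of_closedin)
qed

section \<open>The \<open>p\<close>-Daugavet property\<close>

lemma abs_signed_powr [simp]: "\<bar>signed_powr t p\<bar> = \<bar>t\<bar> powr p"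
  by (simp add: signed_powr_def abs_mult abs_sgn_eq)

lemma signed_powr_minus [simp]: "signed_powr (- t) p = - signed_powr t p"
  by (simp add: signed_powr_def sgn_minus)

lemma signed_powr_mult: "signed_powr (s * t) p = signed_powr s p * signed_powr t p"
  by (simp add: signed_powr_def sgn_mult abs_mult powr_mult)

lemma signed_powr_pos: "t > 0 \<Longrightarrow> signed_powr t p = t powr p"
  by (simp add: signed_powr_def)

text \<open>If \<open>a - b\<close> is small relative to \<open>b\<close>, write
  \<open>a = b * (1 + x)\<close> and use continuity of \<open>(1 + x) powr p\<close> at
  \<open>0\<close>. Otherwise both \<open>\<bar>a\<bar>\<close> and \<open>\<bar>b\<bar>\<close> are
  at most fixed multiples of \<open>\<bar>a - b\<bar>\<close>.\<close>

lemma signed_powr_diff_bound: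
  assumes "p > 0" "\<kappa> > 0"
  obtains C where "C \<ge> 0"
    "\<And>a b. \<bar>signed_powr a p - signed_powr b p\<bar> \<le> \<kappa> * \<bar>b\<bar> powr p + C * \<bar>a - b\<bar> powr p"
proof -
  have "isCont (\<lambda>x :: real. (1 + x) powr p) 0" by (intro continuous_intros) auto
  then obtain \<theta> where \<theta>: "\<theta> > 0" "\<And>x. \<bar>x\<bar> < \<theta> \<Longrightarrow> \<bar>(1 + x) powr p - 1\<bar> < \<kappa>"
    using assms(2) by (auto simp: continuous_at_eps_delta dist_real_def)
  \<comment> \<open>The bound by \<open>1\<close> makes \<open>1 + x\<close> positive, so that
    \<open>a\<close> and \<open>b\<close> have the same sign.\<close>
  define \<eta> where "\<eta> = min \<theta> 1"
  have \<eta>: "\<eta> > 0" "\<eta> \<le> 1" "\<eta> \<le> \<theta>" using \<theta>(1) by (auto simp: \<eta>_def)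
  define C where "C = (1 + 1 / \<eta>) powr p + (1 / \<eta>) powr p"
  have C: "C \<ge> 0" by (simp add: C_def)
  show ?thesis
  proof (rule that[OF C])
    fix a b :: real
    show "\<bar>signed_powr a p - signed_powr b p\<bar> \<le> \<kappa> * \<bar>b\<bar> powr p + C * \<bar>a - b\<bar> powr p"
    proof (cases "\<bar>a - b\<bar> < \<eta> * \<bar>b\<bar>")
      case True
      then have b: "b \<noteq> 0" by auto
      define x where "x = (a - b) / b"
      have x: "\<bar>x\<bar> < \<eta>" using True b by (simp add: x_def field_simps)
      then have pos: "1 + x > 0" using \<eta> by linarith
      have "a = b * (1 + x)" using b by (simp add: x_def field_simps)
      then have "signed_powr a p - signed_powr b p = signed_powr b p * ((1 + x) powr p - 1)"
        using pos by (simp add: signed_powr_mult signed_powr_pos right_diff_distrib)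
      then have "\<bar>signed_powr a p - signed_powr b p\<bar> = \<bar>b\<bar> powr p * \<bar>(1 + x) powr p - 1\<bar>"
        by (simp add: abs_mult)
      also have "\<dots> \<le> \<bar>b\<bar> powr p * \<kappa>"
        using \<theta>(2)[of x] x \<eta> by (intro mult_left_mono) auto
      finally show ?thesis using C by (simp add: mult.commute add_increasing2)
    next
      case False
      then have b: "\<bar>b\<bar> \<le> (1 / \<eta>) * \<bar>a - b\<bar>" using \<eta> by (simp add: field_simps)
      then have a: "\<bar>a\<bar> \<le> (1 + 1 / \<eta>) * \<bar>a - b\<bar>" by (simp add: algebra_simps)
      have "\<bar>signed_powr a p - signed_powr b p\<bar> \<le> \<bar>a\<bar> powr p + \<bar>b\<bar> powr p"
        using abs_triangle_ineq4[of "signed_powr a p" "signed_powr b p"] by simp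
      also have "\<dots> \<le> ((1 + 1 / \<eta>) * \<bar>a - b\<bar>) powr p + ((1 / \<eta>) * \<bar>a - b\<bar>) powr p"
        using a b assms(1) by (intro add_mono powr_mono2) auto
      also have "\<dots> = C * \<bar>a - b\<bar> powr p"
        unfolding C_def powr_mult by (rule distrib_right[symmetric])
      finally show ?thesis using assms(2) by (simp add: add_increasing)
    qed
  qed
qed

section \<open>Norm estimates from \<open>p\<close>-convexity\<close>

locale p_convex_generalized_function_space = generalized_function_space D M rep
  for D :: "'d set" and M :: "'d \<Rightarrow> 'a measure" and rep :: "'x::banach \<Rightarrow> 'd \<Rightarrow> 'a \<Rightarrow> real" +
  fixes p :: real
  assumes p_ge_1: "1 \<le> p" and p_convex: "const1_p_convex D M rep p"
begin

lemma rep_add_AE: "d \<in> D \<Longrightarrow> AE a in M d. rep (x + y) d a = rep x d a + rep y d a"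
  using rep_add by (simp add: ae_eq_def)

lemma rep_scaleR_AE: "d \<in> D \<Longrightarrow> AE a in M d. rep (c *\<^sub>R x) d a = c * rep x d a"
  using rep_scaleR by (simp add: ae_eq_def)

lemma rep_minus_AE: "d \<in> D \<Longrightarrow> AE a in M d. rep (- x) d a = - rep x d a"
  using rep_scaleR_AE[of d "-1" x] by simp

lemma rep_zero_AE: "d \<in> D \<Longrightarrow> AE a in M d. rep 0 d a = 0"
  using rep_scaleR_AE[of d 0 0] by simp

text \<open>The form in which \<open>p\<close>-convexity is applied: combined with the lattice norm
  it turns pointwise domination of \<open>p\<close>-th powers into domination of \<open>p\<close>-th
  powers of norms.\<close>

lemma norm_powr_le_sum:
  fixes x :: "nat \<Rightarrow> 'x"
  assumes "\<And>d. d \<in> D \<Longrightarrow> AE a in M d. \<bar>rep z d a\<bar> powr p \<le> (\<Sum>i<n. \<bar>rep (x i) d a\<bar> powr p)"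
  shows "norm z powr p \<le> (\<Sum>i<n. norm (x i) powr p)"
proof -
  \<comment> \<open>For the moduli \<open>y i\<close> the signed sum is the plain sum of
    \<open>p\<close>-th powers, so the first clause of \<open>const1_p_convex\<close> puts into
    \<open>X\<close> the function whose norm the second clause bounds.\<close>
  define y where "y i = (SOME y. ae_eq D M (rep y) (\<lambda>d a. \<bar>rep (x i) d a\<bar>))" for i
  have y: "ae_eq D M (rep (y i)) (\<lambda>d a. \<bar>rep (x i) d a\<bar>)" for i
    unfolding y_def by (rule someI_ex[OF abs_mem])
  obtain w where w: "ae_eq D M (rep w) (\<lambda>d a. signed_powr (\<Sum>i<n. signed_powr (rep (y i) d a) p) (1 / p))"
    using p_convex unfolding const1_p_convex_def in_gfs_def by blast
  have w': "ae_eq D M (rep w) (\<lambda>d a. (\<Sum>i<n. \<bar>rep (x i) d a\<bar> powr p) powr (1 / p))"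
    unfolding ae_eq_def
  proof
    fix d assume d: "d \<in> D"
    have "AE a in M d. \<forall>i. rep (y i) d a = \<bar>rep (x i) d a\<bar>"
      using y d by (simp add: ae_eq_def AE_all_countable)
    moreover have "AE a in M d. rep w d a = signed_powr (\<Sum>i<n. signed_powr (rep (y i) d a) p) (1 / p)"
      using w d by (simp add: ae_eq_def)
    ultimately show "AE a in M d. rep w d a = (\<Sum>i<n. \<bar>rep (x i) d a\<bar> powr p) powr (1 / p)"
    proof eventually_elim
      case (elim a)
      have s: "signed_powr t q = t powr q" if "t \<ge> 0" for t q :: real
        using that by (simp add: signed_powr_def sgn_if)
      show ?case using elim by (simp add: s sum_nonneg)
    qed
  qed
  have "norm z \<le> norm w"
  proof (rule lattice_norm, unfold ae_le_def, rule ballI)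
    fix d assume d: "d \<in> D"
    have "AE a in M d. rep w d a = (\<Sum>i<n. \<bar>rep (x i) d a\<bar> powr p) powr (1 / p)"
      using w' d by (simp add: ae_eq_def)
    with assms[OF d] show "AE a in M d. \<bar>rep z d a\<bar> \<le> \<bar>rep w d a\<bar>"
    proof eventually_elim
      case (elim a)
      have "\<bar>rep z d a\<bar> = (\<bar>rep z d a\<bar> powr p) powr (1 / p)"
        using p_ge_1 by (simp add: powr_powr)
      also have "\<dots> \<le> (\<Sum>i<n. \<bar>rep (x i) d a\<bar> powr p) powr (1 / p)"
        using elim(1) p_ge_1 by (intro powr_mono2) auto
      finally show ?case using elim(2) by simp
    qed
  qed
  also have "norm w \<le> (\<Sum>i<n. norm (x i) powr p) powr (1 / p)"
    using p_convex unfolding const1_p_convex_def gfs_norm_eq[OF w', symmetric] by blast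
  finally have "norm z powr p \<le> ((\<Sum>i<n. norm (x i) powr p) powr (1 / p)) powr p"
    using p_ge_1 by (intro powr_mono2) auto
  then show ?thesis using p_ge_1 by (simp add: powr_powr sum_nonneg)
qed

text \<open>Passing from representatives to an element of \<open>X\<close> replaces
  \<open>gfs_norm\<close> by the norm. Such an element exists by \<open>p\<close>-convexity and is
  unique by \<open>rep_inject\<close>.\<close>

definition psum :: "'x \<Rightarrow> 'x \<Rightarrow> 'x" where
  "psum x y = (SOME u. ae_eq D M (rep u)
     (\<lambda>d a. signed_powr (signed_powr (rep x d a) p + signed_powr (rep y d a) p) (1 / p)))"

lemma ae_eq_psum:
  "ae_eq D M (rep (psum x y))
     (\<lambda>d a. signed_powr (signed_powr (rep x d a) p + signed_powr (rep y d a) p) (1 / p))"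
proof -
  define z where "z i = (if i = 0 then x else y)" for i :: nat
  have "in_gfs D M rep (\<lambda>d a. signed_powr (\<Sum>i<2. signed_powr (rep (z i) d a) p) (1 / p))"
    using p_convex unfolding const1_p_convex_def by blast
  then have "\<exists>u. ae_eq D M (rep u)
     (\<lambda>d a. signed_powr (signed_powr (rep x d a) p + signed_powr (rep y d a) p) (1 / p))"
    by (simp add: in_gfs_def z_def numeral_2_eq_2)
  then show ?thesis unfolding psum_def by (rule someI_ex)
qed

lemma psum_AE:
  assumes "d \<in> D"
  shows "AE a in M d. \<bar>rep (psum x y) d a\<bar> powr p = \<bar>signed_powr (rep x d a) p + signed_powr (rep y d a) p\<bar>"
  using ae_eq_psum[of x y, unfolded ae_eq_def, rule_format, OF assms]
  by eventually_elim (use p_ge_1 in \<open>simp add: powr_powr\<close>)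

lemma gfs_norm_psum:
  "gfs_norm D M rep (\<lambda>d a. signed_powr (signed_powr (rep x d a) p + signed_powr (rep y d a) p) (1 / p))
     = norm (psum x y)"
  by (rule gfs_norm_eq[OF ae_eq_psum])

lemma p_daugavet_equation_iff:
  "p_daugavet_equation D M rep p T \<longleftrightarrow>
     (SUP f\<in>cball 0 1. norm (psum f (blinfun_apply T f))) = (1 + norm T powr p) powr (1 / p)"
  by (simp add: p_daugavet_equation_def gfs_norm_psum)

lemma norm_psum_powr_le: "norm (psum x y) powr p \<le> norm x powr p + norm y powr p"
proof -
  define z where "z i = (if i = 0 then x else y)" for i :: nat
  have "norm (psum x y) powr p \<le> (\<Sum>i<2. norm (z i) powr p)"
  proof (rule norm_powr_le_sum)
    fix d assume "d \<in> D"
    from psum_AE[OF this, of x y]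
    show "AE a in M d. \<bar>rep (psum x y) d a\<bar> powr p \<le> (\<Sum>i<2. \<bar>rep (z i) d a\<bar> powr p)"
    proof eventually_elim
      case (elim a)
      then show ?case
        using abs_triangle_ineq[of "signed_powr (rep x d a) p" "signed_powr (rep y d a) p"]
        by (simp add: z_def numeral_2_eq_2)
    qed
  qed
  then show ?thesis by (simp add: z_def numeral_2_eq_2)
qed

lemma psum_minus: "psum (- x) (- y) = - psum x y"
proof (rule rep_inject, unfold ae_eq_def, rule ballI)
  fix d assume d: "d \<in> D"
  show "AE a in M d. rep (psum (- x) (- y)) d a = rep (- psum x y) d a"
    using ae_eq_psum[of x y, unfolded ae_eq_def, rule_format, OF d]
      ae_eq_psum[of "- x" "- y", unfolded ae_eq_def, rule_format, OF d]
      rep_minus_AE[OF d, of x] rep_minus_AE[OF d, of y] rep_minus_AE[OF d, of "psum x y"]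
  proof eventually_elim
    case (elim a)
    then show ?case
      using signed_powr_minus[of "signed_powr (rep x d a) p + signed_powr (rep y d a) p" "1 / p"] by simp
  qed
qed

lemma psum_zero: "psum x 0 = x"
proof (rule rep_inject, unfold ae_eq_def, rule ballI)
  fix d assume d: "d \<in> D"
  show "AE a in M d. rep (psum x 0) d a = rep x d a"
    using ae_eq_psum[of x 0, unfolded ae_eq_def, rule_format, OF d] rep_zero_AE[OF d]
    by eventually_elim (use p_ge_1 signed_powr_inverse in \<open>simp add: signed_powr_def[of 0]\<close>)
qed

lemma psum_uminus_self: "psum x (- x) = 0"
proof (rule rep_inject, unfold ae_eq_def, rule ballI)
  fix d assume d: "d \<in> D"
  show "AE a in M d. rep (psum x (- x)) d a = rep 0 d a"
    using ae_eq_psum[of x "- x", unfolded ae_eq_def, rule_format, OF d] rep_zero_AE[OF d]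
      rep_minus_AE[OF d, of x]
    by eventually_elim (simp add: signed_powr_def[of 0])
qed

text \<open>Pointwise, replacing \<open>y\<close> by \<open>z\<close> costs at most the difference
  of their signed powers. The hypothesis bounds it by \<open>p\<close>-th powers of multiples of
  \<open>y\<close> and \<open>z - y\<close>, with \<open>p\<close>-th roots of
  \<open>\<kappa>\<close> and \<open>C\<close> as factors, and \<open>norm_powr_le_sum\<close>
  applies to the three terms.\<close>

lemma norm_psum_perturb:
  assumes C: "C \<ge> 0" "\<kappa> \<ge> 0"
    "\<And>a b. \<bar>signed_powr a p - signed_powr b p\<bar> \<le> \<kappa> * \<bar>b\<bar> powr p + C * \<bar>a - b\<bar> powr p"
  shows "norm (psum x z) powr p \<le> norm (psum x y) powr p + \<kappa> * norm y powr p + C * norm (z - y) powr p"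
proof -
  define w where "w i = (if i = 0 then psum x y else if i = 1 then \<kappa> powr (1 / p) *\<^sub>R y
    else C powr (1 / p) *\<^sub>R (z - y))" for i :: nat
  have sum3: "(\<Sum>i<3. f i) = f 0 + f 1 + f 2" for f :: "nat \<Rightarrow> real"
    by (simp add: numeral_3_eq_3 numeral_2_eq_2)
  have root: "(t powr (1 / p)) powr p = t" if "t \<ge> 0" for t
    using that p_ge_1 by (simp add: powr_powr)
  have "norm (psum x z) powr p \<le> (\<Sum>i<3. norm (w i) powr p)"
  proof (rule norm_powr_le_sum)
    fix d assume d: "d \<in> D"
    show "AE a in M d. \<bar>rep (psum x z) d a\<bar> powr p \<le> (\<Sum>i<3. \<bar>rep (w i) d a\<bar> powr p)"
      using psum_AE[OF d, of x y] psum_AE[OF d, of x z] rep_scaleR_AE[OF d, of "\<kappa> powr (1 / p)" y]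
        rep_scaleR_AE[OF d, of "C powr (1 / p)" "z - y"] rep_add_AE[OF d, of "z - y" y]
    proof eventually_elim
      case (elim a)
      have z: "rep (z - y) d a = rep z d a - rep y d a" using elim(5) by simp
      have "\<bar>rep (psum x z) d a\<bar> powr p \<le> \<bar>signed_powr (rep x d a) p + signed_powr (rep y d a) p\<bar>
          + \<bar>signed_powr (rep z d a) p - signed_powr (rep y d a) p\<bar>"
        unfolding elim(2) by linarith
      also have "\<dots> \<le> \<bar>rep (psum x y) d a\<bar> powr p + (\<kappa> * \<bar>rep y d a\<bar> powr p + C * \<bar>rep z d a - rep y d a\<bar> powr p)"
        using elim(1) C(3) by (intro add_mono) auto
      also have "\<dots> = (\<Sum>i<3. \<bar>rep (w i) d a\<bar> powr p)"
        using elim(3,4) z C by (simp add: sum3 w_def abs_mult powr_mult root)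
      finally show ?case .
    qed
  qed
  then show ?thesis using C by (simp add: sum3 w_def powr_mult root)
qed

end

section \<open>From rank one to weakly compact operators\<close>

locale p_daugavet_space = p_convex_generalized_function_space D M rep p
  for D :: "'d set" and M :: "'d \<Rightarrow> 'a measure" and rep :: "'x::banach \<Rightarrow> 'd \<Rightarrow> 'a \<Rightarrow> real"
    and p :: real +
  assumes p_daugavet: "p_daugavet_property D M rep p"
begin

text \<open>Apply the equation to the rank one operator \<open>R\<close> sending \<open>f\<close> to
  \<open>g f *\<^sub>R x\<close>. If \<open>f\<close> is almost maximal, the upper bound
  \<open>1 + \<bar>g f\<bar> powr p * norm x powr p\<close> forces \<open>\<bar>g f\<bar>\<close> to
  be close to \<open>1\<close>; a negative sign is removed by passing to \<open>- f\<close>.\<close>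

lemma p_daugavet_slice:
  fixes g :: "'x \<Rightarrow>\<^sub>L real" and x :: 'x
  assumes g: "norm g = 1" and x: "x \<noteq> 0" and s: "s < 1" and \<delta>: "\<delta> > 0"
  obtains f where "norm f \<le> 1" "s < g f" "1 + norm x powr p - \<delta> < norm (psum f (g f *\<^sub>R x)) powr p"
proof -
  define R where "R = blinfun_scaleR_left x o\<^sub>L g"
  have R: "R f = g f *\<^sub>R x" for f by (simp add: R_def)
  have nR: "norm R = norm x"
    using onorm_scaleR_left[OF blinfun.bounded_linear_right[of g], of x] g
    by (simp add: norm_blinfun.rep_eq R[abs_def])
  have "g \<noteq> 0" using g by auto
  then obtain f1 where f1: "g f1 \<noteq> 0" by (metis blinfun_eqI zero_blinfun.rep_eq)
  have "rank_one R"
    unfolding rank_one_def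
  proof (rule dim_unique)
    have "R (inverse (g f1) *\<^sub>R f1) = x" using f1 by (simp add: R blinfun.scaleR_right)
    then show "{x} \<subseteq> range R" by (metis empty_subsetI insert_subset rangeI)
    show "range R \<subseteq> span {x}" by (auto simp: R intro: span_mul span_base)
  qed (use x in auto)
  then have eq: "(SUP f\<in>cball 0 1. norm (psum f (R f))) = (1 + norm x powr p) powr (1 / p)"
    using p_daugavet nR by (simp add: p_daugavet_property_def p_daugavet_equation_iff)
  define X where "X = norm x powr p"
  have X: "X > 0" using x by (simp add: X_def)
  define s' where "s' = max s 0"
  have s': "0 \<le> s'" "s' < 1" "s \<le> s'" using s by (auto simp: s'_def)
  have s'p: "s' powr p < 1" using s' p_ge_1 powr_less_mono2[of p s' 1] by simp
  \<comment> \<open>The second bound gives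
    \<open>1 + X - \<epsilon> \<ge> 1 + X * s' powr p\<close>, so almost maximality yields
    \<open>s' < \<bar>g f\<bar>\<close>; it also keeps \<open>1 + X - \<epsilon>\<close>
    nonnegative.\<close>
  define \<epsilon> where "\<epsilon> = min \<delta> (X * (1 - s' powr p))"
  have \<epsilon>: "\<epsilon> > 0" "\<epsilon> \<le> \<delta>" "\<epsilon> \<le> X * (1 - s' powr p)"
    using \<delta> X s'p by (auto simp: \<epsilon>_def min_def)
  have "X * (1 - s' powr p) \<le> X" using X by (simp add: mult_left_le)
  then have base: "0 \<le> 1 + X - \<epsilon>" using \<epsilon> by simp
  have "\<exists>f\<in>cball 0 1. (1 + X - \<epsilon>) powr (1 / p) < norm (psum f (R f))"
  proof (rule ccontr)
    assume "\<not> ?thesis"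
    then have "(SUP f\<in>cball 0 1. norm (psum f (R f))) \<le> (1 + X - \<epsilon>) powr (1 / p)"
      by (intro cSUP_least) (auto simp: not_less)
    then have "(1 + X) powr (1 / p) \<le> (1 + X - \<epsilon>) powr (1 / p)" by (simp add: eq X_def)
    moreover have "(1 + X - \<epsilon>) powr (1 / p) < (1 + X) powr (1 / p)"
      using base \<epsilon> p_ge_1 by (intro powr_less_mono2) auto
    ultimately show False by simp
  qed
  then obtain f where f: "norm f \<le> 1" "(1 + X - \<epsilon>) powr (1 / p) < norm (psum f (R f))" by auto
  have "((1 + X - \<epsilon>) powr (1 / p)) powr p < norm (psum f (R f)) powr p"
    using f p_ge_1 by (intro powr_less_mono2) auto
  then have big: "1 + X - \<epsilon> < norm (psum f (g f *\<^sub>R x)) powr p"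
    using base p_ge_1 by (simp add: powr_powr R)
  also have "\<dots> \<le> norm f powr p + norm (g f *\<^sub>R x) powr p" by (rule norm_psum_powr_le)
  also have "\<dots> \<le> 1 + \<bar>g f\<bar> powr p * X"
    using f(1) p_ge_1 powr_mono2[of p "norm f" 1] by (simp add: powr_mult X_def)
  finally have "X * (1 - s' powr p) > X * (1 - \<bar>g f\<bar> powr p)"
    using \<epsilon> by (simp add: algebra_simps)
  then have "s' powr p < \<bar>g f\<bar> powr p" using X by simp
  then have gf: "s' < \<bar>g f\<bar>"
    using p_ge_1 powr_mono2[of p "\<bar>g f\<bar>" s'] by (meson abs_ge_zero not_le order_trans zero_le_one)
  show ?thesis
  proof (cases "g f \<ge> 0")
    case True
    then show ?thesis using that[of f] f gf s' big \<epsilon> by (auto simp: X_def)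
  next
    case False
    have "psum (- f) (g (- f) *\<^sub>R x) = - psum f (g f *\<^sub>R x)"
      by (simp add: blinfun.minus_right psum_minus)
    then show ?thesis using that[of "- f"] f gf s' big \<epsilon> False by (auto simp: X_def blinfun.minus_right)
  qed
qed

text \<open>The error \<open>\<tau>\<close> is split into four quarters: for the choice of
  \<open>f\<close> in the slice, for \<open>norm x powr p\<close> falling short of
  \<open>norm T powr p\<close>, and for the two error terms of \<open>norm_psum_perturb\<close> when
  \<open>g f *\<^sub>R x\<close> is replaced by \<open>T f\<close>.\<close>

lemma weakly_compact_almost_daugavet:
  assumes T: "weakly_compact_operator T" and pos: "norm T > 0" and \<tau>: "0 < \<tau>" "\<tau> < norm T powr p"
  obtains f where "norm f \<le> 1" "1 + norm T powr p - \<tau> < norm (psum f (blinfun_apply T f)) powr p"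
proof -
  define N where "N = norm T powr p"
  have N: "N > 0" using pos by (simp add: N_def)
  have p0: "p > 0" using p_ge_1 by simp
  define \<kappa> where "\<kappa> = \<tau> / (4 * N)"
  have \<kappa>: "\<kappa> > 0" using \<tau> N by (simp add: \<kappa>_def)
  obtain C where C: "C \<ge> 0"
    "\<And>a b. \<bar>signed_powr a p - signed_powr b p\<bar> \<le> \<kappa> * \<bar>b\<bar> powr p + C * \<bar>a - b\<bar> powr p"
    using signed_powr_diff_bound[OF p0 \<kappa>] by blast
  \<comment> \<open>The admissible distance between \<open>g f *\<^sub>R x\<close> and
    \<open>T f\<close>, making \<open>C * r powr p\<close> at most \<open>\<tau> / 4\<close>; the
    denominator \<open>C + 1\<close> allows for \<open>C = 0\<close>.\<close>
  define r where "r = (\<tau> / (4 * (C + 1))) powr (1 / p)"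
  have r: "r > 0" using \<tau> C by (simp add: r_def)
  have "r powr p = \<tau> / (4 * (C + 1))" using \<tau> C p0 by (simp add: r_def powr_powr)
  then have "C * r powr p = (\<tau> / 4) * (C / (C + 1))" by simp
  also have "\<dots> \<le> \<tau> / 4" using \<tau> C by (intro mult_left_le) (auto simp: divide_le_eq)
  finally have Cr: "C * r powr p \<le> \<tau> / 4" .
  define t where "t = (N - \<tau> / 4) powr (1 / p)"
  have "N - \<tau> / 4 > 0" using \<tau> by (simp add: N_def)
  then have tp: "t powr p = N - \<tau> / 4" and t0: "t > 0" using p0 by (simp_all add: t_def powr_powr)
  have tT: "t < norm T"
  proof (rule ccontr)
    assume "\<not> t < norm T"
    then have "N \<le> t powr p" using p0 by (simp add: N_def powr_mono2)
    then show False using tp \<tau> by simp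
  qed
  have e: "0 < min (r / 2) t" "min (r / 2) t \<le> t" using r t0 by auto
  obtain g :: "'x \<Rightarrow>\<^sub>L real" and x s where g: "norm g = 1" "s < 1" "t < norm x" "norm x \<le> norm T"
    and sl: "\<And>f. norm f \<le> 1 \<Longrightarrow> s < g f \<Longrightarrow> norm (T f - x) \<le> min (r / 2) t"
    by (rule weakly_compact_operator_slice[OF T t0 tT e]) (rule that; blast)
  \<comment> \<open>The second bound gives \<open>(1 - g f) * norm x \<le> r / 2\<close>; the other
    half of \<open>r\<close> is the distance from \<open>T f\<close> to \<open>x\<close>.\<close>
  define s' where "s' = max s (1 - r / (2 * norm T))"
  have "s' < 1" using g(2) r pos by (simp add: s'_def)
  moreover have "x \<noteq> 0" using g(3) t0 by auto
  ultimately obtain f where f: "norm f \<le> 1" "s' < g f"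
      "1 + norm x powr p - \<tau> / 4 < norm (psum f (g f *\<^sub>R x)) powr p"
    using p_daugavet_slice[OF g(1), of x s' "\<tau> / 4"] \<tau> by auto
  have "g f \<le> 1" using norm_blinfun[of g f] g(1) f(1) by simp
  have "norm (g f *\<^sub>R x - x) = (1 - g f) * norm x"
  proof -
    have "g f *\<^sub>R x - x = (g f - 1) *\<^sub>R x" by (simp add: algebra_simps)
    then show ?thesis using \<open>g f \<le> 1\<close> by simp
  qed
  also have "\<dots> \<le> (r / (2 * norm T)) * norm T"
    using f(2) \<open>g f \<le> 1\<close> g(4) r by (intro mult_mono) (auto simp: s'_def)
  also have "\<dots> = r / 2" using pos by simp
  finally have "norm (g f *\<^sub>R x - x) \<le> r / 2" .
  moreover have "norm (T f - x) \<le> r / 2" using sl[OF f(1)] f(2) by (simp add: s'_def)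
  ultimately have close: "norm (g f *\<^sub>R x - T f) \<le> r"
    using norm_triangle_ineq4[of "g f *\<^sub>R x - x" "T f - x"] by simp
  have "norm (T f) \<le> norm T * 1"
    using norm_blinfun[of T f] f(1) by (metis mult_left_mono norm_ge_zero order_trans)
  then have "\<kappa> * norm (T f) powr p \<le> \<kappa> * N"
    using \<kappa> p0 by (intro mult_left_mono) (auto simp: N_def powr_mono2)
  also have "\<dots> = \<tau> / 4" using N by (simp add: \<kappa>_def)
  finally have 1: "\<kappa> * norm (T f) powr p \<le> \<tau> / 4" .
  have "C * norm (g f *\<^sub>R x - T f) powr p \<le> C * r powr p"
    using close C p0 by (intro mult_left_mono powr_mono2) auto
  then have 2: "C * norm (g f *\<^sub>R x - T f) powr p \<le> \<tau> / 4" using Cr by simp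
  have 3: "N - \<tau> / 4 \<le> norm x powr p"
    using powr_mono2[of p t "norm x"] g(3) t0 p0 tp by simp
  show ?thesis
  proof (rule that[OF f(1)])
    show "1 + norm T powr p - \<tau> < norm (psum f (T f)) powr p"
      using norm_psum_perturb[OF C(1) less_imp_le[OF \<kappa>] C(2), of f "g f *\<^sub>R x" "T f"] 1 2 3 f(3)
      unfolding N_def by linarith
  qed
qed

text \<open>The upper bound comes from \<open>p\<close>-convexity, the lower one from
  \<open>weakly_compact_almost_daugavet\<close> with arbitrarily small error. For
  \<open>T = 0\<close> the supremum is the largest norm in the unit ball, which is \<open>1\<close>
  because a non-zero vector exists.\<close>

lemma weakly_compact_imp_p_daugavet_equation:
  assumes T: "weakly_compact_operator T" and nontrivial: "\<exists>x :: 'x. x \<noteq> 0"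
  shows "p_daugavet_equation D M rep p T"
proof -
  define S where "S = (SUP f\<in>cball 0 1. norm (psum f (T f)))"
  have p0: "p > 0" using p_ge_1 by simp
  have upper: "norm (psum f (T f)) \<le> (1 + norm T powr p) powr (1 / p)" if "f \<in> cball 0 1" for f
  proof -
    have "norm (T f) \<le> norm T * 1"
      using norm_blinfun[of T f] that by (metis mem_cball_0 mult_left_mono norm_ge_zero order_trans)
    then have "norm f powr p + norm (T f) powr p \<le> 1 + norm T powr p"
      using that p0 powr_mono2[of p "norm f" 1] by (intro add_mono powr_mono2) auto
    then have "norm (psum f (T f)) powr p \<le> 1 + norm T powr p"
      using norm_psum_powr_le[of f "T f"] by simp
    then have "(norm (psum f (T f)) powr p) powr (1 / p) \<le> (1 + norm T powr p) powr (1 / p)"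
      using p0 by (intro powr_mono2) auto
    then show ?thesis using p0 by (simp add: powr_powr)
  qed
  have lower: "norm (psum f (T f)) \<le> S" if "norm f \<le> 1" for f
    unfolding S_def using that upper by (intro cSUP_upper bdd_aboveI2) auto
  have S0: "0 \<le> S" using order_trans[OF norm_ge_zero lower[of 0]] by simp
  have "1 + norm T powr p \<le> S powr p"
  proof (cases "T = 0")
    case True
    obtain x :: 'x where x: "x \<noteq> 0" using nontrivial by blast
    have "1 \<le> S"
      using lower[of "inverse (norm x) *\<^sub>R x"] x by (simp add: True psum_zero)
    then show ?thesis using True p0 by (simp add: ge_one_powr_ge_zero)
  next
    case False
    then have pos: "norm T > 0" by simp
    show ?thesis
    proof (rule ccontr)
      assume neg: "\<not> 1 + norm T powr p \<le> S powr p"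
      \<comment> \<open>The second bound keeps \<open>\<tau>\<close> strictly below
        \<open>norm T powr p\<close>, as the approximation lemma requires.\<close>
      define \<tau> where "\<tau> = min ((1 + norm T powr p) - S powr p) (norm T powr p / 2)"
      have "0 < \<tau>" "\<tau> < norm T powr p" "\<tau> \<le> (1 + norm T powr p) - S powr p"
        using neg pos by (auto simp: \<tau>_def min_def)
      then obtain f where "norm f \<le> 1" "1 + norm T powr p - \<tau> < norm (psum f (T f)) powr p"
        using weakly_compact_almost_daugavet[OF T pos] by blast
      moreover have "norm (psum f (T f)) powr p \<le> S powr p"
        using lower[OF \<open>norm f \<le> 1\<close>] p0 by (simp add: powr_mono2)
      ultimately show False using \<open>\<tau> \<le> (1 + norm T powr p) - S powr p\<close> by simp
    qed
  qed
  then have "(1 + norm T powr p) powr (1 / p) \<le> (S powr p) powr (1 / p)"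
    using p0 by (intro powr_mono2) auto
  then have "(1 + norm T powr p) powr (1 / p) \<le> S" using p0 S0 by (simp add: powr_powr)
  moreover have "S \<le> (1 + norm T powr p) powr (1 / p)"
    unfolding S_def using upper by (intro cSUP_least) auto
  ultimately show ?thesis by (simp add: p_daugavet_equation_iff S_def)
qed

lemma not_reflexive:
  assumes nontrivial: "\<exists>x :: 'x. x \<noteq> 0"
  shows "\<not> reflexive_space TYPE('x)"
proof
  let ?T = "- id_blinfun :: 'x \<Rightarrow>\<^sub>L 'x"
  assume "reflexive_space TYPE('x)"
  then have "p_daugavet_equation D M rep p ?T"
    by (intro weakly_compact_imp_p_daugavet_equation reflexive_imp_weakly_compact_uminus nontrivial)
  moreover have "norm (psum f (?T f)) = 0" for f
    by (simp add: uminus_blinfun.rep_eq psum_uminus_self)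
  ultimately have "0 = (1 + norm ?T powr p) powr (1 / p)"
    by (simp add: p_daugavet_equation_iff)
  moreover have "0 < 1 + norm ?T powr p" by (simp add: add_pos_nonneg)
  ultimately show False by simp
qed

end

text \<open>For the zero space the \<open>p\<close>-Daugavet property is vacuous, while the equation
  fails for \<open>T = 0\<close> and the space is reflexive; the hypothesis
  \<open>nontrivial\<close> excludes this case.\<close>

theorem theorem3p1:
  fixes D :: "'d set"
    and M :: "'d \<Rightarrow> 'a measure"
    and rep :: "'x::banach \<Rightarrow> 'd \<Rightarrow> 'a \<Rightarrow> real"
    and p :: real
  assumes "1 \<le> p"
    and "generalized_function_space D M rep"
    and nontrivial: "\<exists>x :: 'x. x \<noteq> 0"
    and "const1_p_convex D M rep p"
    and "p_daugavet_property D M rep p"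
  shows "(\<forall>T :: 'x \<Rightarrow>\<^sub>L 'x. weakly_compact_operator T \<longrightarrow> p_daugavet_equation D M rep p T)
         \<and> \<not> reflexive_space TYPE('x)"
proof -
  interpret generalized_function_space D M rep by fact
  interpret p_daugavet_space D M rep p
    using assms by unfold_locales
  show ?thesis
    using weakly_compact_imp_p_daugavet_equation not_reflexive nontrivial by blast
qed

end
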